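(* Let $\Lambda,\Gamma\subseteq\mathbb{R}^d$ be relatively separated, and let $P:\ell^2(\Gamma)\to\ell^2(\Gamma)$ and $A:\ell^2(\Gamma)\to\ell^2(\Lambda)$ be bounded operators, represented by matrices $P=(P_{\gamma,\gamma'})_{\gamma,\gamma'\in\Gamma}$ and $A=(A_{\lambda,\gamma})_{\lambda\in\Lambda,\gamma\in\Gamma}$. Assume that $P^2=P$ and that, for some $\Theta\in W(C_0,L^1)(\mathbb{R}^d)$, $$|A_{\lambda,\gamma}|\le\Theta(\lambda-\gamma)\quad(\lambda\in\Lambda,\gamma\in\Gamma),\qquad |P_{\gamma,\gamma'}|\le\Theta(\gamma-\gamma')\quad(\gamma,\gamma'\in\Gamma).$$ Let $p\in[1,\infty]$ and assume that there exists $C_p>0$ such that $$\|APc\|_p\ge C_p\|Pc\|_p,\qquad c\in\ell^p(\Gamma).$$ Then there exists $C'>0$ such that for all $q\in[1,\infty]$ $$\|APc\|_q\ge C'\|Pc\|_q,\qquad c\in\ell^q(\Gamma).$$ Moreover, $C'$ is independent of $q$ and depends only on $\Theta$, $C_p$, and upper bounds for the relative separation of $\Lambda$ and $\Gamma$.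
   Context: A set $\Lambda\subseteq\mathbb{R}^d$ is relatively separated if its relative separation $\operatorname{rel}(\Lambda):=\sup_{x\in\mathbb{R}^d}\#(\Lambda\cap B_1(x))$ is finite, $B_1(x)$ being the Euclidean unit ball centered at $x$. $W(L^\infty,L^1)(\mathbb{R}^d)$ is the space of $f\in L^\infty(\mathbb{R}^d)$ with $\int_{\mathbb{R}^d}\|f\|_{L^\infty(B_1(x))}\,dx<\infty$, and $W(C_0,L^1)(\mathbb{R}^d)$ is its closed subspace of continuous functions. By the matrix bounds, $A$ and $P$ act boundedly on $\ell^p$ for every $p\in[1,\infty]$ by matrix multiplication; $\|\cdot\|_p$ denotes the norm of $\ell^p(\Gamma)$ or $\ell^p(\Lambda)$. *)

theory Defs
  imports "HOL-Analysis.Analysis" "HOL-Probability.Essential_Supremum"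
begin

text \<open>
  The relative separation takes values in the extended nonnegative reals. Counting measure is used
  instead of \<open>card\<close>, since \<open>card\<close> vanishes on infinite sets.
\<close>

definition rel :: "(real ^ 'n) set \<Rightarrow> ennreal" where
  "rel \<Lambda> = (SUP x. emeasure (count_space UNIV) (\<Lambda> \<inter> ball x 1))"

definition relatively_separated :: "(real ^ 'n) set \<Rightarrow> bool" where
  "relatively_separated \<Lambda> \<longleftrightarrow> rel \<Lambda> < \<infinity>"

definition Linf_norm :: "(real ^ 'n) set \<Rightarrow> (real ^ 'n \<Rightarrow> real) \<Rightarrow> ennreal" where
  "Linf_norm S f = esssup (lebesgue_on S) (\<lambda>y. ennreal \<bar>f y\<bar>)"

definition W_Linf_L1 :: "(real ^ 'n \<Rightarrow> real) set" where
  "W_Linf_L1 = {f \<in> borel_measurable lebesgue.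
     Linf_norm UNIV f < \<infinity> \<and> (\<integral>\<^sup>+x. Linf_norm (ball x 1) f \<partial>lebesgue) < \<infinity>}"

definition W_C0_L1 :: "(real ^ 'n \<Rightarrow> real) set" where
  "W_C0_L1 = {f \<in> W_Linf_L1. continuous_on UNIV f}"

text \<open>
  A sequence indexed by a set \<open>S\<close> is a function on the whole type that vanishes off \<open>S\<close>. In the
  supremum norm, \<open>0\<close> is inserted because the real \<open>Sup\<close> of the empty set is unspecified.
\<close>

definition lp_norm :: "'a set \<Rightarrow> ereal \<Rightarrow> ('a \<Rightarrow> complex) \<Rightarrow> real" where
  "lp_norm S p c =
     (if p = \<infinity> then Sup (insert 0 ((\<lambda>x. norm (c x)) ` S))
      else (\<Sum>\<^sub>\<infinity>x\<in>S. norm (c x) powr real_of_ereal p) powr (1 / real_of_ereal p))"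

definition lp :: "'a set \<Rightarrow> ereal \<Rightarrow> ('a \<Rightarrow> complex) set" where
  "lp S p = {c. (\<forall>x. x \<notin> S \<longrightarrow> c x = 0) \<and>
     (if p = \<infinity> then bdd_above ((\<lambda>x. norm (c x)) ` S)
      else (\<lambda>x. norm (c x) powr real_of_ereal p) summable_on S)}"

definition bounded_l2_operator ::
    "'a set \<Rightarrow> 'b set \<Rightarrow> (('a \<Rightarrow> complex) \<Rightarrow> ('b \<Rightarrow> complex)) \<Rightarrow> bool" where
  "bounded_l2_operator \<Gamma> \<Lambda> T \<longleftrightarrow>
     (\<forall>c\<in>lp \<Gamma> 2. T c \<in> lp \<Lambda> 2) \<and>
     (\<forall>c\<in>lp \<Gamma> 2. \<forall>d\<in>lp \<Gamma> 2. T (\<lambda>x. c x + d x) = (\<lambda>y. T c y + T d y)) \<and>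
     (\<forall>a. \<forall>c\<in>lp \<Gamma> 2. T (\<lambda>x. a * c x) = (\<lambda>y. a * T c y)) \<and>
     (\<exists>B. \<forall>c\<in>lp \<Gamma> 2. lp_norm \<Lambda> 2 (T c) \<le> B * lp_norm \<Gamma> 2 c)"

definition represented_by ::
    "'a set \<Rightarrow> 'b set \<Rightarrow> (('a \<Rightarrow> complex) \<Rightarrow> ('b \<Rightarrow> complex)) \<Rightarrow> ('b \<Rightarrow> 'a \<Rightarrow> complex) \<Rightarrow> bool" where
  "represented_by \<Gamma> \<Lambda> T M \<longleftrightarrow>
     (\<forall>c\<in>lp \<Gamma> 2. \<forall>y\<in>\<Lambda>. ((\<lambda>x. M y x * c x) has_sum T c y) \<Gamma>)"

text \<open>
  Matrix multiplication, used for the action on every \<open>\<ell>\<^sup>p\<close>. The series converges absolutely for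
  \<open>c\<close> in any \<open>\<ell>\<^sup>p\<close> when the entries are dominated by an envelope in \<open>W_C0_L1\<close> and the index sets
  are relatively separated, so the default value of the infinite sum plays no role there.
\<close>

definition mat_apply ::
    "'a set \<Rightarrow> 'b set \<Rightarrow> ('b \<Rightarrow> 'a \<Rightarrow> complex) \<Rightarrow> ('a \<Rightarrow> complex) \<Rightarrow> ('b \<Rightarrow> complex)" where
  "mat_apply \<Gamma> \<Lambda> M c = (\<lambda>y. if y \<in> \<Lambda> then \<Sum>\<^sub>\<infinity>x\<in>\<Gamma>. M y x * c x else 0)"

end

theory Submission imports Defs begin

text \<open>
  The theorem is an instance of spectral invariance, proved by localisation with a version
  of Sjostrand's commutator argument. Let \<open>w\<^sub>k\<close> be multiplication by the weight
  \<open>bump N k x = exp (- norm (x - node k) / N)\<close>, where the centres \<open>node k\<close> run through a fine lattice.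

  The commutator of \<open>w\<^sub>k\<close> with a matrix of envelope \<open>\<Theta>\<close> is small for large \<open>N\<close>, because \<open>bump N k\<close> varies
  slowly and \<open>\<Theta>\<close> has a summable majorant on the cells of the lattice (\<open>W_C0_L1_summable_envelope\<close>). More
  precisely, the \<open>\<ell>\<^sup>p\<close> norm of the commutator applied to \<open>d\<close> is at most a discrete convolution of the local
  norms \<open>a\<^sub>j = \<parallel>w\<^sub>j d\<parallel>\<^sub>p\<close> with a kernel whose total mass tends to \<open>0\<close> as \<open>N \<longrightarrow> \<infinity>\<close>
  (\<open>lp_bound_commutator\<close>, \<open>modulus_sum_small\<close>).

  Now let \<open>d = P c\<close> with \<open>c\<close> in \<open>\<ell>\<^sup>q\<close>; then \<open>P d = d\<close> (\<open>mat_apply_idempotent\<close>). The assumed bound with exponent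
  \<open>p\<close>, applied to \<open>w\<^sub>k d\<close>, gives after commuting \<open>w\<^sub>k\<close> past \<open>P\<close> and \<open>A\<close> that \<open>C\<^sub>p a\<^sub>k\<close> is at most
  \<open>\<parallel>w\<^sub>k A d\<parallel>\<^sub>p\<close> plus such a small convolution (\<open>local_lower_bound\<close>). Taking \<open>\<ell>\<^sup>q\<close> norms in \<open>k\<close>, the convolution
  is absorbed by the left-hand side. For fixed \<open>N\<close> the \<open>\<ell>\<^sup>q\<close> norms of \<open>k \<mapsto> \<parallel>w\<^sub>k d\<parallel>\<^sub>p\<close> and \<open>k \<mapsto> \<parallel>w\<^sub>k A d\<parallel>\<^sub>p\<close>
  compare with the \<open>\<ell>\<^sup>q\<close> norms of \<open>d\<close> and \<open>A d\<close>, from below and from above respectively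
  (\<open>lp_bound_from_local_norms\<close>, \<open>lp_bound_local_norms\<close>). All operator bounds come from the Schur test and
  Minkowski's inequality, whose constants do not depend on the exponent; this makes \<open>C'\<close> independent
  of \<open>p\<close> and \<open>q\<close>.
\<close>

section \<open>Sequence norms, Minkowski's inequality and the Schur test\<close>

lemma powr_above_tangent:
  fixes x t r :: real
  assumes "0 \<le> x" "0 < t" "1 \<le> r"
  shows "t powr r + r * t powr (r - 1) * (x - t) \<le> x powr r"
proof (cases "x = 0")
  case True
  have "t powr (r - 1) * t = t powr r"
    using assms by (metis add.commute diff_add_cancel less_eq_real_def powr_add powr_one)
  moreover have "t powr r \<le> r * t powr r"
    using assms by (simp add: mult_le_cancel_right1)
  ultimately show ?thesis
    using True assms by (simp add: algebra_simps)
next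
  case False
  have "x powr r - t powr r \<ge> (r * t powr (r - 1)) * (x - t)"
  proof (rule convex_on_imp_above_tangent[where A = "{0<..}"])
    show "convex_on {0<..} (\<lambda>x. x powr r)"
      using assms by (intro powr_convex)
    show "((\<lambda>x. x powr r) has_real_derivative r * t powr (r - 1)) (at t within {0<..})"
      using assms by (auto intro!: derivative_eq_intros)
  qed (use assms False in \<open>auto simp: interior_open\<close>)
  then show ?thesis by simp
qed

lemma nonneg_summable_infsum_le:
  fixes f :: "'a \<Rightarrow> real"
  assumes "\<And>x. x \<in> S \<Longrightarrow> 0 \<le> f x"
    and "\<And>F. finite F \<Longrightarrow> F \<subseteq> S \<Longrightarrow> sum f F \<le> B"
  shows "f summable_on S" "infsum f S \<le> B"
proof -
  show s: "f summable_on S"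
    by (rule nonneg_bdd_above_summable_on) (use assms in \<open>auto simp: bdd_above_def\<close>)
  show "infsum f S \<le> B"
    by (rule infsum_le_finite_sums[OF s]) (use assms in auto)
qed

lemma has_sum_finite_sum:
  fixes f :: "'b \<Rightarrow> 'a \<Rightarrow> real"
  assumes "finite F" "\<And>x. x \<in> F \<Longrightarrow> (f x has_sum s x) I"
  shows "((\<lambda>i. \<Sum>x\<in>F. f x i) has_sum (\<Sum>x\<in>F. s x)) I"
  using assms by (induction F rule: finite_induct) (auto intro: has_sum_add)

lemma infsum_finite_sum:
  fixes f :: "'b \<Rightarrow> 'a \<Rightarrow> real"
  assumes "finite F" "\<And>x. x \<in> F \<Longrightarrow> f x summable_on I"
  shows "(\<Sum>\<^sub>\<infinity>i\<in>I. \<Sum>x\<in>F. f x i) = (\<Sum>x\<in>F. \<Sum>\<^sub>\<infinity>i\<in>I. f x i)"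
  by (rule infsumI has_sum_finite_sum has_sum_infsum assms | assumption)+

lemma summable_on_finite_sum:
  fixes f :: "'b \<Rightarrow> 'a \<Rightarrow> real"
  assumes "finite F" "\<And>x. x \<in> F \<Longrightarrow> f x summable_on I"
  shows "(\<lambda>i. \<Sum>x\<in>F. f x i) summable_on I"
  by (rule has_sum_imp_summable[OF has_sum_finite_sum[OF assms(1) has_sum_infsum]]) (rule assms(2))

text \<open>
  Jensen's inequality for a nonnegative weight of arbitrary total mass. With \<open>t\<close> the weighted mean,
  summing the tangent line of \<open>x \<mapsto> x\<^sup>r\<close> at \<open>t\<close> against the weight makes the linear term vanish.
  Both Minkowski's inequality and the Schur test below are instances.
\<close>

lemma powr_infsum_le:
  fixes w x :: "'i \<Rightarrow> real"
  assumes r: "1 \<le> r" and w: "\<And>i. i \<in> I \<Longrightarrow> 0 \<le> w i" and x: "\<And>i. i \<in> I \<Longrightarrow> 0 \<le> x i"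
    and sw: "w summable_on I" and sx: "(\<lambda>i. w i * x i) summable_on I"
    and sr: "(\<lambda>i. w i * x i powr r) summable_on I"
  shows "(\<Sum>\<^sub>\<infinity>i\<in>I. w i * x i) powr r
    \<le> (\<Sum>\<^sub>\<infinity>i\<in>I. w i) powr (r - 1) * (\<Sum>\<^sub>\<infinity>i\<in>I. w i * x i powr r)"
proof -
  define W where "W = (\<Sum>\<^sub>\<infinity>i\<in>I. w i)"
  define Q where "Q = (\<Sum>\<^sub>\<infinity>i\<in>I. w i * x i)"
  have W0: "0 \<le> W" and Q0: "0 \<le> Q"
    unfolding W_def Q_def using w x by (auto intro!: infsum_nonneg)
  have R0: "0 \<le> (\<Sum>\<^sub>\<infinity>i\<in>I. w i * x i powr r)"
    using w x by (auto intro!: infsum_nonneg)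
  show ?thesis
  proof (cases "Q = 0")
    case True
    then show ?thesis using R0 by (simp add: Q_def[symmetric])
  next
    case False
    have "W \<noteq> 0"
    proof
      assume "W = 0"
      then have "w i = 0" if "i \<in> I" for i
        using nonneg_infsum_le_0D[of w I i] sw w that by (simp add: W_def)
      then have "Q = 0" unfolding Q_def by (intro infsum_0) auto
      with False show False ..
    qed
    with W0 Q0 False have W: "0 < W" and Q: "0 < Q" by auto
    define t where "t = Q / W"
    have t: "0 < t" using W Q by (simp add: t_def)
    have h1: "((\<lambda>i. w i * (t powr r) + r * t powr (r - 1) * (w i * x i + w i * (- t)))
        has_sum W * (t powr r) + r * t powr (r - 1) * (Q + W * (- t))) I"
      unfolding W_def Q_def using sw sx
      by (intro has_sum_add has_sum_cmult_left has_sum_cmult_right has_sum_infsum)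
    have "W * (t powr r) + r * t powr (r - 1) * (Q + W * (- t)) \<le> (\<Sum>\<^sub>\<infinity>i\<in>I. w i * x i powr r)"
    proof (rule has_sum_mono[OF h1 has_sum_infsum[OF sr]])
      fix i assume i: "i \<in> I"
      have "w i * (t powr r + r * t powr (r - 1) * (x i - t)) \<le> w i * x i powr r"
        using powr_above_tangent[OF x[OF i] t r] w[OF i] by (rule mult_left_mono)
      then show "w i * (t powr r) + r * t powr (r - 1) * (w i * x i + w i * (- t)) \<le> w i * x i powr r"
        by (simp add: algebra_simps)
    qed
    moreover have "Q + W * (- t) = 0" using W by (simp add: t_def)
    ultimately have "W * t powr r \<le> (\<Sum>\<^sub>\<infinity>i\<in>I. w i * x i powr r)" by simp
    then have "W powr (r - 1) * (W * t powr r) \<le> W powr (r - 1) * (\<Sum>\<^sub>\<infinity>i\<in>I. w i * x i powr r)"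
      by (intro mult_left_mono) auto
    moreover have "W powr (r - 1) * W = W powr r"
      using W by (simp add: powr_diff)
    then have "W powr (r - 1) * (W * t powr r) = Q powr r"
      using W Q by (simp add: t_def powr_divide mult.assoc[symmetric])
    ultimately show ?thesis by (simp add: W_def Q_def)
  qed
qed

text \<open>
  An upper bound for the \<open>\<ell>\<^sup>p\<close> norm that, being stated through finite partial sums, includes membership
  in \<open>\<ell>\<^sup>p\<close>. An inequality for \<open>lp_norm\<close> alone would not, because a divergent series has the value \<open>0\<close>.
\<close>

definition lp_bound :: "ereal \<Rightarrow> 'a set \<Rightarrow> ('a \<Rightarrow> real) \<Rightarrow> real \<Rightarrow> bool" where
  "lp_bound p S f B \<longleftrightarrow> 0 \<le> B \<and>
     (if p = \<infinity> then \<forall>x\<in>S. \<bar>f x\<bar> \<le> B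
      else \<forall>F. finite F \<longrightarrow> F \<subseteq> S \<longrightarrow>
        (\<Sum>x\<in>F. \<bar>f x\<bar> powr real_of_ereal p) \<le> B powr real_of_ereal p)"

lemma exponent_cases:
  fixes p :: ereal
  assumes "1 \<le> p"
  obtains (infinite) "p = \<infinity>" | (finite) r where "p = ereal r" "1 \<le> r"
  using assms by (cases p) auto

lemma lp_bound_infinity: "lp_bound \<infinity> S f B \<longleftrightarrow> 0 \<le> B \<and> (\<forall>x\<in>S. \<bar>f x\<bar> \<le> B)"
  by (simp add: lp_bound_def)

lemma lp_bound_real:
  "lp_bound (ereal r) S f B \<longleftrightarrow>
     0 \<le> B \<and> (\<forall>F. finite F \<longrightarrow> F \<subseteq> S \<longrightarrow> (\<Sum>x\<in>F. \<bar>f x\<bar> powr r) \<le> B powr r)"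
  by (simp add: lp_bound_def)

lemma lp_bound_nonneg: "lp_bound p S f B \<Longrightarrow> 0 \<le> B"
  by (simp add: lp_bound_def)

lemma lp_bound_pointwise:
  assumes p: "1 \<le> p" and f: "lp_bound p S f B" and x: "x \<in> S"
  shows "\<bar>f x\<bar> \<le> B"
  using p
proof (cases rule: exponent_cases)
  case infinite
  then show ?thesis using f x by (simp add: lp_bound_infinity)
next
  case (finite r)
  then have "(\<Sum>x\<in>{x}. \<bar>f x\<bar> powr r) \<le> B powr r" and "0 \<le> B"
    using f x unfolding finite lp_bound_real by blast+
  then show ?thesis using finite powr_less_mono2[of r B "\<bar>f x\<bar>"] by force
qed

lemma lp_bound_mono:
  assumes p: "1 \<le> p" and g: "lp_bound p S g B" and "B \<le> B'"
    and fg: "\<And>x. x \<in> S \<Longrightarrow> \<bar>f x\<bar> \<le> \<bar>g x\<bar>"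
  shows "lp_bound p S f B'"
  using p
proof (cases rule: exponent_cases)
  case infinite
  then show ?thesis using g fg assms(3) unfolding infinite lp_bound_infinity by force
next
  case (finite r)
  have "(\<Sum>x\<in>F. \<bar>f x\<bar> powr r) \<le> B' powr r" if F: "finite F" "F \<subseteq> S" for F
  proof -
    have "(\<Sum>x\<in>F. \<bar>f x\<bar> powr r) \<le> (\<Sum>x\<in>F. \<bar>g x\<bar> powr r)"
      using F fg finite by (intro sum_mono powr_mono2) auto
    also have "\<dots> \<le> B powr r" using g F finite by (simp add: lp_bound_real)
    also have "\<dots> \<le> B' powr r"
      using assms(3) lp_bound_nonneg[OF g] finite by (intro powr_mono2) auto
    finally show ?thesis .
  qed
  then show ?thesis using lp_bound_nonneg[OF g] assms(3) unfolding finite lp_bound_real by auto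
qed

lemma lp_bound_scale:
  assumes p: "1 \<le> p" and f: "lp_bound p S f B"
  shows "lp_bound p S (\<lambda>x. a * f x) (\<bar>a\<bar> * B)"
  using p
proof (cases rule: exponent_cases)
  case infinite
  then show ?thesis using f by (auto simp: lp_bound_infinity abs_mult intro: mult_left_mono)
next
  case (finite r)
  have "(\<Sum>x\<in>F. \<bar>a * f x\<bar> powr r) = \<bar>a\<bar> powr r * (\<Sum>x\<in>F. \<bar>f x\<bar> powr r)" for F
    by (simp add: abs_mult powr_mult sum_distrib_left)
  moreover have "(\<bar>a\<bar> * B) powr r = \<bar>a\<bar> powr r * B powr r"
    using lp_bound_nonneg[OF f] by (simp add: powr_mult)
  ultimately show ?thesis using f unfolding finite lp_bound_real
    by (simp add: mult_left_mono)
qed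

lemma lp_bound_reindex:
  assumes p: "1 \<le> p" and f: "lp_bound p S f B" and g: "inj_on g T" "g ` T \<subseteq> S"
  shows "lp_bound p T (\<lambda>x. f (g x)) B"
  using p
proof (cases rule: exponent_cases)
  case infinite
  then show ?thesis using f g by (auto simp: lp_bound_infinity)
next
  case (finite r)
  have "(\<Sum>x\<in>F. \<bar>f (g x)\<bar> powr r) \<le> B powr r" if F: "finite F" "F \<subseteq> T" for F
  proof -
    have "(\<Sum>x\<in>F. \<bar>f (g x)\<bar> powr r) = (\<Sum>y\<in>g ` F. \<bar>f y\<bar> powr r)"
      using inj_on_subset[OF g(1) F(2)] by (simp add: sum.reindex)
    also have "\<dots> \<le> B powr r" using f F g(2) unfolding finite lp_bound_real by blast
    finally show ?thesis .
  qed
  then show ?thesis using lp_bound_nonneg[OF f] by (simp add: finite lp_bound_real)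
qed

lemma sum_powr_le_powr_sum:
  fixes a :: "'a \<Rightarrow> real"
  assumes "finite F" "\<And>x. x \<in> F \<Longrightarrow> 0 \<le> a x" "1 \<le> r"
  shows "(\<Sum>x\<in>F. a x powr r) \<le> (\<Sum>x\<in>F. a x) powr r"
proof -
  define s where "s = (\<Sum>x\<in>F. a x)"
  have s: "0 \<le> s" unfolding s_def using assms by (auto intro: sum_nonneg)
  have pw: "y powr r = y * y powr (r - 1)" if "0 \<le> y" for y :: real
    using that assms(3) by (cases "y = 0") (auto simp: powr_diff)
  have "(\<Sum>x\<in>F. a x powr r) = (\<Sum>x\<in>F. a x * a x powr (r - 1))"
    using assms pw by (intro sum.cong) auto
  also have "\<dots> \<le> (\<Sum>x\<in>F. a x * s powr (r - 1))"
    using assms s unfolding s_def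
    by (intro sum_mono mult_left_mono powr_mono2 member_le_sum) auto
  also have "\<dots> = s powr r" using pw[OF s] by (simp add: s_def sum_distrib_right)
  finally show ?thesis by (simp add: s_def)
qed

text \<open>
  The contraction \<open>\<ell>\<^sup>1 \<rightarrow> \<ell>\<^sup>p\<close>; it is the way to compare local \<open>\<ell>\<^sup>p\<close> norms with other exponents without
  a constant that depends on \<open>p\<close>.
\<close>

lemma lp_bound_of_summable:
  assumes p: "1 \<le> p" and s: "(\<lambda>x. \<bar>f x\<bar>) summable_on S"
  shows "lp_bound p S f (\<Sum>\<^sub>\<infinity>x\<in>S. \<bar>f x\<bar>)"
  using p
proof (cases rule: exponent_cases)
  case infinite
  have "\<bar>f x\<bar> \<le> (\<Sum>\<^sub>\<infinity>x\<in>S. \<bar>f x\<bar>)" if "x \<in> S" for x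
    using finite_sum_le_infsum[OF s, of "{x}"] that by simp
  then show ?thesis by (simp add: infinite lp_bound_infinity infsum_nonneg)
next
  case (finite r)
  have "(\<Sum>x\<in>F. \<bar>f x\<bar> powr r) \<le> (\<Sum>\<^sub>\<infinity>x\<in>S. \<bar>f x\<bar>) powr r" if F: "finite F" "F \<subseteq> S" for F
  proof -
    have "(\<Sum>x\<in>F. \<bar>f x\<bar> powr r) \<le> (\<Sum>x\<in>F. \<bar>f x\<bar>) powr r"
      using F finite by (intro sum_powr_le_powr_sum) auto
    also have "\<dots> \<le> (\<Sum>\<^sub>\<infinity>x\<in>S. \<bar>f x\<bar>) powr r"
      using F finite by (intro powr_mono2 finite_sum_le_infsum s sum_nonneg) auto
    finally show ?thesis .
  qed
  then show ?thesis by (simp add: finite lp_bound_real infsum_nonneg)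
qed

text \<open>
  Minkowski's inequality for infinite families. For finite \<open>p\<close>, write \<open>\<bar>g i x\<bar>\<close> as the weight \<open>B i\<close> times the
  normalised value \<open>\<bar>g i x\<bar> / B i\<close>, apply Jensen's inequality at each \<open>x\<close>, and sum over \<open>x\<close>.
\<close>

lemma lp_bound_infsum:
  fixes g :: "'i \<Rightarrow> 'a \<Rightarrow> real"
  assumes p: "1 \<le> p" and g: "\<And>i. i \<in> I \<Longrightarrow> lp_bound p S (g i) (B i)"
    and B: "B summable_on I"
    and f: "\<And>x. x \<in> S \<Longrightarrow> \<bar>f x\<bar> \<le> (\<Sum>\<^sub>\<infinity>i\<in>I. \<bar>g i x\<bar>)"
  shows "lp_bound p S f (\<Sum>\<^sub>\<infinity>i\<in>I. B i)"
proof -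
  have B0: "0 \<le> B i" if "i \<in> I" for i using lp_bound_nonneg[OF g[OF that]] .
  have gB: "\<bar>g i x\<bar> \<le> B i" if "i \<in> I" "x \<in> S" for i x
    using lp_bound_pointwise[OF p g] that by blast
  have sg: "(\<lambda>i. \<bar>g i x\<bar>) summable_on I" if "x \<in> S" for x
    by (rule summable_on_comparison_test[OF B]) (use gB that in auto)
  have b0: "0 \<le> infsum B I" using B0 by (rule infsum_nonneg)
  show ?thesis using p
  proof (cases rule: exponent_cases)
    case infinite
    have "\<bar>f x\<bar> \<le> infsum B I" if "x \<in> S" for x
      using f[OF that] infsum_mono[OF sg[OF that] B] gB that by fastforce
    then show ?thesis using b0 by (simp add: infinite lp_bound_infinity)
  next
    case (finite r)
    define h where "h = (\<lambda>i x. \<bar>g i x\<bar> / B i)"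
    have h: "0 \<le> h i x" "B i * h i x = \<bar>g i x\<bar>" "h i x powr r \<le> 1" if "i \<in> I" "x \<in> S" for i x
    proof -
      show "0 \<le> h i x" using B0[OF that(1)] by (simp add: h_def)
      show "B i * h i x = \<bar>g i x\<bar>" using gB[OF that] by (cases "B i = 0") (auto simp: h_def)
      have "h i x \<le> 1" using gB[OF that] B0[OF that(1)]
        by (cases "B i = 0") (auto simp: h_def divide_le_eq)
      then show "h i x powr r \<le> 1" using \<open>0 \<le> h i x\<close> finite
        by (simp add: powr_le1)
    qed
    have sr: "(\<lambda>i. B i * h i x powr r) summable_on I" if "x \<in> S" for x
      by (rule summable_on_comparison_test[OF B])
        (use h that B0 in \<open>auto simp: mult_left_le\<close>)
    have "(\<Sum>x\<in>F. \<bar>f x\<bar> powr r) \<le> infsum B I powr r" if F: "finite F" "F \<subseteq> S" for F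
    proof -
      have "(\<Sum>x\<in>F. \<bar>f x\<bar> powr r)
          \<le> (\<Sum>x\<in>F. infsum B I powr (r - 1) * (\<Sum>\<^sub>\<infinity>i\<in>I. B i * h i x powr r))"
      proof (rule sum_mono)
        fix x assume "x \<in> F"
        with F have x: "x \<in> S" by auto
        have eq: "(\<Sum>\<^sub>\<infinity>i\<in>I. \<bar>g i x\<bar>) = (\<Sum>\<^sub>\<infinity>i\<in>I. B i * h i x)"
          using h x by (intro infsum_cong) auto
        have "\<bar>f x\<bar> powr r \<le> (\<Sum>\<^sub>\<infinity>i\<in>I. B i * h i x) powr r"
          using f[OF x] finite eq by (intro powr_mono2) auto
        also have "\<dots> \<le> infsum B I powr (r - 1) * (\<Sum>\<^sub>\<infinity>i\<in>I. B i * h i x powr r)"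
        proof (rule powr_infsum_le)
          show "(\<lambda>i. B i * h i x) summable_on I"
            using sg[OF x] h x by (simp cong: summable_on_cong)
        qed (use finite B0 h x B sr in auto)
        finally show "\<bar>f x\<bar> powr r \<le> infsum B I powr (r - 1) * (\<Sum>\<^sub>\<infinity>i\<in>I. B i * h i x powr r)" .
      qed
      also have "\<dots> = infsum B I powr (r - 1) * (\<Sum>\<^sub>\<infinity>i\<in>I. \<Sum>x\<in>F. B i * h i x powr r)"
        using F sr by (subst infsum_finite_sum) (auto simp: sum_distrib_left)
      also have "\<dots> \<le> infsum B I powr (r - 1) * infsum B I"
      proof (intro mult_left_mono infsum_mono B)
        show "(\<lambda>i. \<Sum>x\<in>F. B i * h i x powr r) summable_on I"
          using F sr by (intro summable_on_finite_sum) auto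
        fix i assume i: "i \<in> I"
        show "(\<Sum>x\<in>F. B i * h i x powr r) \<le> B i"
        proof (cases "B i = 0")
          case False
          then have Bi: "0 < B i" using B0[OF i] by simp
          have "(\<Sum>x\<in>F. \<bar>g i x\<bar> powr r) \<le> B i powr r"
            using g[OF i] F finite by (simp add: lp_bound_real)
          moreover have "(\<Sum>x\<in>F. h i x powr r) = (\<Sum>x\<in>F. \<bar>g i x\<bar> powr r) / B i powr r"
            using Bi by (simp add: h_def powr_divide sum_divide_distrib)
          ultimately have "(\<Sum>x\<in>F. h i x powr r) \<le> 1" using Bi by simp
          then show ?thesis using Bi by (simp add: sum_distrib_left[symmetric])
        qed simp
      qed simp
      also have "\<dots> = infsum B I powr r"
        using b0 finite by (cases "infsum B I = 0") (auto simp: powr_diff)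
      finally show ?thesis .
    qed
    then show ?thesis using b0 by (simp add: finite lp_bound_real)
  qed
qed

lemma lp_bound_add:
  assumes p: "1 \<le> p" and g: "lp_bound p S g B" and h: "lp_bound p S h C"
    and f: "\<And>x. x \<in> S \<Longrightarrow> \<bar>f x\<bar> \<le> \<bar>g x\<bar> + \<bar>h x\<bar>"
  shows "lp_bound p S f (B + C)"
proof -
  have "lp_bound p S f (\<Sum>\<^sub>\<infinity>i\<in>UNIV. if i then B else C)"
    by (rule lp_bound_infsum[where g = "\<lambda>i. if i then g else h"])
      (use p g h f in \<open>auto simp: UNIV_bool add.commute\<close>)
  then show ?thesis by (simp add: UNIV_bool add.commute)
qed

text \<open>
  With row and column sums bounded by the same \<open>H\<close>, the bound is \<open>H\<close> for every exponent. This uniformity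
  is what makes the final constant independent of \<open>p\<close> and \<open>q\<close>. For finite exponents, Jensen's
  inequality along a row produces \<open>H\<^sup>r\<^sup>-\<^sup>1\<close>, and summation along the columns the remaining factor.
\<close>

lemma schur_test:
  fixes M :: "'b \<Rightarrow> 'a \<Rightarrow> real"
  assumes p: "1 \<le> p" and g: "lp_bound p S g B" and H: "0 \<le> H"
    and M: "\<And>x y. x \<in> T \<Longrightarrow> y \<in> S \<Longrightarrow> 0 \<le> M x y"
    and row: "\<And>x F. x \<in> T \<Longrightarrow> finite F \<Longrightarrow> F \<subseteq> S \<Longrightarrow> (\<Sum>y\<in>F. M x y) \<le> H"
    and col: "\<And>y F. y \<in> S \<Longrightarrow> finite F \<Longrightarrow> F \<subseteq> T \<Longrightarrow> (\<Sum>x\<in>F. M x y) \<le> H"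
    and f: "\<And>x. x \<in> T \<Longrightarrow> \<bar>f x\<bar> \<le> (\<Sum>\<^sub>\<infinity>y\<in>S. M x y * \<bar>g y\<bar>)"
  shows "lp_bound p T f (H * B)"
proof -
  have B0: "0 \<le> B" using lp_bound_nonneg[OF g] .
  have gB: "\<bar>g y\<bar> \<le> B" if "y \<in> S" for y using lp_bound_pointwise[OF p g that] .
  have sM: "M x summable_on S" "infsum (M x) S \<le> H" if "x \<in> T" for x
    using nonneg_summable_infsum_le[of S "M x" H] M row that by auto
  have sg: "(\<lambda>y. M x y * \<bar>g y\<bar>) summable_on S" if "x \<in> T" for x
    by (rule summable_on_comparison_test[OF summable_on_cmult_left[OF sM(1)[OF that], of B]])
      (use M gB that in \<open>auto intro!: mult_left_mono mult_nonneg_nonneg\<close>)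
  show ?thesis using p
  proof (cases rule: exponent_cases)
    case infinite
    have "\<bar>f x\<bar> \<le> H * B" if x: "x \<in> T" for x
    proof -
      have "\<bar>f x\<bar> \<le> (\<Sum>\<^sub>\<infinity>y\<in>S. M x y * B)"
        using f[OF x] infsum_mono[OF sg[OF x] summable_on_cmult_left[OF sM(1)[OF x], of B]]
          M gB x by (fastforce intro: mult_left_mono)
      also have "\<dots> = infsum (M x) S * B" by (rule infsum_cmult_left) (use sM x in auto)
      also have "\<dots> \<le> H * B" using sM(2)[OF x] B0 by (rule mult_right_mono)
      finally show ?thesis .
    qed
    then show ?thesis using H B0 by (simp add: infinite lp_bound_infinity)
  next
    case (finite r)
    have sr: "(\<lambda>y. M x y * \<bar>g y\<bar> powr r) summable_on S" if "x \<in> T" for x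
      by (rule summable_on_comparison_test[OF summable_on_cmult_left[OF sM(1)[OF that], of "B powr r"]])
        (use M gB that finite in \<open>auto intro!: mult_left_mono mult_nonneg_nonneg powr_mono2\<close>)
    have sgr: "(\<lambda>y. \<bar>g y\<bar> powr r) summable_on S" "(\<Sum>\<^sub>\<infinity>y\<in>S. \<bar>g y\<bar> powr r) \<le> B powr r"
      using nonneg_summable_infsum_le[of S "\<lambda>y. \<bar>g y\<bar> powr r" "B powr r"] g
      unfolding finite lp_bound_real by auto
    have "(\<Sum>x\<in>F. \<bar>f x\<bar> powr r) \<le> (H * B) powr r" if F: "finite F" "F \<subseteq> T" for F
    proof -
      have "(\<Sum>x\<in>F. \<bar>f x\<bar> powr r)
          \<le> (\<Sum>x\<in>F. H powr (r - 1) * (\<Sum>\<^sub>\<infinity>y\<in>S. M x y * \<bar>g y\<bar> powr r))"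
      proof (rule sum_mono)
        fix x assume "x \<in> F"
        with F have x: "x \<in> T" by auto
        have "\<bar>f x\<bar> powr r \<le> (\<Sum>\<^sub>\<infinity>y\<in>S. M x y * \<bar>g y\<bar>) powr r"
          using f[OF x] finite by (intro powr_mono2) auto
        also have "\<dots> \<le> infsum (M x) S powr (r - 1) * (\<Sum>\<^sub>\<infinity>y\<in>S. M x y * \<bar>g y\<bar> powr r)"
          by (rule powr_infsum_le) (use finite M x sM sg sr in auto)
        also have "\<dots> \<le> H powr (r - 1) * (\<Sum>\<^sub>\<infinity>y\<in>S. M x y * \<bar>g y\<bar> powr r)"
          using sM[OF x] M x finite
          by (intro mult_right_mono powr_mono2 infsum_nonneg) auto
        finally show "\<bar>f x\<bar> powr r \<le> H powr (r - 1) * (\<Sum>\<^sub>\<infinity>y\<in>S. M x y * \<bar>g y\<bar> powr r)" .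
      qed
      also have "\<dots> = H powr (r - 1) * (\<Sum>\<^sub>\<infinity>y\<in>S. \<Sum>x\<in>F. M x y * \<bar>g y\<bar> powr r)"
        using F sr by (subst infsum_finite_sum) (auto simp: sum_distrib_left)
      also have "\<dots> \<le> H powr (r - 1) * (\<Sum>\<^sub>\<infinity>y\<in>S. H * \<bar>g y\<bar> powr r)"
      proof (intro mult_left_mono infsum_mono summable_on_cmult_right sgr)
        show "(\<lambda>y. \<Sum>x\<in>F. M x y * \<bar>g y\<bar> powr r) summable_on S"
          using F sr by (intro summable_on_finite_sum) auto
        show "(\<Sum>x\<in>F. M x y * \<bar>g y\<bar> powr r) \<le> H * \<bar>g y\<bar> powr r" if "y \<in> S" for y
          using col[OF that F] by (simp add: sum_distrib_right[symmetric] mult_right_mono)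
      qed simp
      also have "\<dots> = H powr r * (\<Sum>\<^sub>\<infinity>y\<in>S. \<bar>g y\<bar> powr r)"
        using H sgr finite by (cases "H = 0") (auto simp: infsum_cmult_right powr_diff)
      also have "\<dots> \<le> H powr r * B powr r" using sgr by (intro mult_left_mono) auto
      also have "\<dots> = (H * B) powr r" using H B0 by (simp add: powr_mult)
      finally show ?thesis .
    qed
    then show ?thesis using H B0 by (simp add: finite lp_bound_real)
  qed
qed

lemma lp_bound_lp_norm:
  assumes p: "1 \<le> p" and c: "c \<in> lp S p"
  shows "lp_bound p S (\<lambda>x. norm (c x)) (lp_norm S p c)"
  using p
proof (cases rule: exponent_cases)
  case infinite
  have b: "bdd_above (insert 0 ((\<lambda>x. norm (c x)) ` S))"
    using c by (simp add: lp_def infinite)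
  show ?thesis
    using cSup_upper[OF _ b] by (auto simp: infinite lp_bound_infinity lp_norm_def)
next
  case (finite r)
  have s: "(\<lambda>x. norm (c x) powr r) summable_on S" using c by (simp add: lp_def finite)
  have "0 \<le> (\<Sum>\<^sub>\<infinity>x\<in>S. norm (c x) powr r)" by (intro infsum_nonneg) auto
  then have "lp_norm S p c powr r = (\<Sum>\<^sub>\<infinity>x\<in>S. norm (c x) powr r)"
    using finite by (simp add: lp_norm_def powr_powr)
  then show ?thesis using finite_sum_le_infsum[OF s]
    by (auto simp: finite lp_bound_real lp_norm_def)
qed

lemma lp_norm_le:
  assumes p: "1 \<le> p" and c: "lp_bound p S (\<lambda>x. norm (c x)) B" and "\<And>x. x \<notin> S \<Longrightarrow> c x = 0"
  shows "c \<in> lp S p" "lp_norm S p c \<le> B"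
proof -
  have "c \<in> lp S p \<and> lp_norm S p c \<le> B" using p
  proof (cases rule: exponent_cases)
    case infinite
    then have "\<forall>x\<in>S. norm (c x) \<le> B" "0 \<le> B" using c by (auto simp: lp_bound_infinity)
    then show ?thesis using assms(3)
      by (auto simp: infinite lp_def lp_norm_def bdd_above_def intro!: cSup_least)
  next
    case (finite r)
    have c': "0 \<le> B" "(\<Sum>x\<in>F. norm (c x) powr r) \<le> B powr r" if "finite F" "F \<subseteq> S" for F
      using c that by (auto simp: finite lp_bound_real)
    have s: "(\<lambda>x. norm (c x) powr r) summable_on S"
      "(\<Sum>\<^sub>\<infinity>x\<in>S. norm (c x) powr r) \<le> B powr r"
      using nonneg_summable_infsum_le[of S "\<lambda>x. norm (c x) powr r" "B powr r"] c' by auto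
    have "lp_norm S p c \<le> (B powr r) powr (1 / r)"
      using s finite by (auto simp: lp_norm_def intro!: powr_mono2 infsum_nonneg)
    also have "\<dots> = B" using c'(1)[of "{}"] finite by (simp add: powr_powr)
    finally show ?thesis using s assms(3) by (simp add: finite lp_def)
  qed
  then show "c \<in> lp S p" "lp_norm S p c \<le> B" by auto
qed

section \<open>A fine lattice and relatively separated sets\<close>

text \<open>
  Cells of side \<open>1 / (d + 1)\<close> have Euclidean diameter less than \<open>1\<close> in dimension \<open>d\<close>. Hence a cell lies in
  the unit ball around each of its points, the ball in which both the relative separation and the
  amalgam norm are measured.
\<close>

definition cell :: "real ^ 'n \<Rightarrow> int ^ 'n" where
  "cell x = (\<chi> i. \<lfloor>x $ i * (real CARD('n) + 1)\<rfloor>)"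

definition node :: "int ^ 'n \<Rightarrow> real ^ 'n" where
  "node k = (\<chi> i. of_int (k $ i) / (real CARD('n) + 1))"

lemma node_add: "node (j + k) = node j + node k"
  by (simp add: node_def vec_eq_iff add_divide_distrib)

lemma node_diff: "node (j - k) = node j - node k"
  by (simp add: node_def vec_eq_iff diff_divide_distrib)

lemma norm_less_1_if_components_small:
  fixes z :: "real ^ 'n"
  assumes "\<And>i. \<bar>z $ i\<bar> * (real CARD('n) + 1) \<le> 1"
  shows "norm z < 1"
proof -
  have "norm z \<le> (\<Sum>i\<in>UNIV. \<bar>z $ i\<bar>)" by (rule norm_le_l1_cart)
  also have "\<dots> \<le> (\<Sum>i\<in>(UNIV :: 'n set). 1 / (real CARD('n) + 1))"
    using assms by (intro sum_mono) (simp add: pos_le_divide_eq)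
  also have "\<dots> < 1" by (simp add: divide_less_eq)
  finally show ?thesis .
qed

lemma norm_diff_node_cell:
  fixes x :: "real ^ 'n"
  shows "norm (x - node (cell x)) < 1"
proof (rule norm_less_1_if_components_small)
  fix i :: 'n
  let ?D = "real CARD('n) + 1"
  have "\<bar>(x - node (cell x)) $ i\<bar> * ?D = \<bar>((x - node (cell x)) $ i) * ?D\<bar>"
    by (simp add: abs_mult)
  also have "((x - node (cell x)) $ i) * ?D = x $ i * ?D - of_int \<lfloor>x $ i * ?D\<rfloor>"
    by (simp add: node_def cell_def left_diff_distrib)
  also have "\<bar>\<dots>\<bar> \<le> 1" by linarith
  finally show "\<bar>(x - node (cell x)) $ i\<bar> * ?D \<le> 1" .
qed

lemma norm_diff_same_cell:
  fixes x y :: "real ^ 'n"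
  assumes "cell x = cell y"
  shows "norm (x - y) < 1"
proof (rule norm_less_1_if_components_small)
  fix i :: 'n
  let ?D = "real CARD('n) + 1"
  have "\<lfloor>x $ i * ?D\<rfloor> = \<lfloor>y $ i * ?D\<rfloor>"
    using assms by (simp add: cell_def vec_eq_iff)
  then have "\<bar>x $ i * ?D - y $ i * ?D\<bar> \<le> 1" by linarith
  then show "\<bar>(x - y) $ i\<bar> * ?D \<le> 1"
    by (simp add: left_diff_distrib[symmetric] abs_mult)
qed

definition at_most_per_ball :: "real \<Rightarrow> (real ^ 'n) set \<Rightarrow> bool" where
  "at_most_per_ball R \<Gamma> \<longleftrightarrow> (\<forall>x. finite (\<Gamma> \<inter> ball x 1) \<and> real (card (\<Gamma> \<inter> ball x 1)) \<le> R)"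

lemma at_most_per_ball_nonneg: "at_most_per_ball R \<Gamma> \<Longrightarrow> 0 \<le> R"
  unfolding at_most_per_ball_def by (meson of_nat_0_le_iff order_trans)

lemma at_most_per_ball_rel:
  assumes "rel \<Gamma> \<le> ennreal R" "0 \<le> R"
  shows "at_most_per_ball R \<Gamma>"
  unfolding at_most_per_ball_def
proof (intro allI)
  fix x
  have le: "emeasure (count_space UNIV) (\<Gamma> \<inter> ball x 1) \<le> ennreal R"
    using assms(1) unfolding rel_def by (auto simp: SUP_le_iff)
  have fin: "finite (\<Gamma> \<inter> ball x 1)"
    using le by (auto simp: emeasure_count_space top_unique split: if_splits)
  moreover have "ennreal (real (card (\<Gamma> \<inter> ball x 1))) \<le> ennreal R"
    using le fin by (simp add: emeasure_count_space ennreal_of_nat_eq_real_of_nat)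
  ultimately show "finite (\<Gamma> \<inter> ball x 1) \<and> real (card (\<Gamma> \<inter> ball x 1)) \<le> R"
    using assms(2) by simp
qed

text \<open>
  The map \<open>\<tau>\<close> stands for \<open>cell\<close> composed with a translation or a reflection: a fibre then lies in the
  unit ball around any of its points.
\<close>

lemma sum_fibre_le:
  fixes \<tau> :: "real ^ 'n \<Rightarrow> 'b"
  assumes \<Gamma>: "at_most_per_ball R \<Gamma>" and F: "finite F" "F \<subseteq> \<Gamma>"
    and \<tau>: "\<And>y z. \<tau> y = \<tau> z \<Longrightarrow> norm (y - z) < 1"
  shows "(\<Sum>y\<in>F. of_bool (\<tau> y = m)) \<le> R"
proof (cases "\<exists>y\<in>F. \<tau> y = m")
  case True
  then obtain v where v: "\<tau> v = m" by auto
  have sub: "{y \<in> F. \<tau> y = m} \<subseteq> \<Gamma> \<inter> ball v 1"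
    using F \<tau>[of v] v by (auto simp: dist_norm)
  have "(\<Sum>y\<in>F. of_bool (\<tau> y = m)) = real (card {y \<in> F. \<tau> y = m})"
    using F(1) by (simp add: of_bool_def sum.If_cases Int_def)
  also have "\<dots> \<le> real (card (\<Gamma> \<inter> ball v 1))"
    using sub \<Gamma> by (simp add: at_most_per_ball_def card_mono)
  also have "\<dots> \<le> R" using \<Gamma> by (simp add: at_most_per_ball_def)
  finally show ?thesis .
next
  case False
  then have "(\<Sum>y\<in>F. of_bool (\<tau> y = m)) = (0::real)" by (intro sum.neutral) auto
  also have "0 \<le> R"
    using \<Gamma> by (rule at_most_per_ball_nonneg)
  finally show ?thesis .
qed

lemma sum_weight_le:
  fixes \<tau> :: "real ^ 'n \<Rightarrow> 'b"
  assumes \<Gamma>: "at_most_per_ball R \<Gamma>" and F: "finite F" "F \<subseteq> \<Gamma>"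
    and \<tau>: "\<And>y z. \<tau> y = \<tau> z \<Longrightarrow> norm (y - z) < 1"
    and w: "\<And>m. 0 \<le> w m" "w summable_on UNIV"
  shows "(\<Sum>y\<in>F. w (\<tau> y)) \<le> R * (\<Sum>\<^sub>\<infinity>m. w m)"
proof -
  have R: "0 \<le> R"
    using \<Gamma> by (rule at_most_per_ball_nonneg)
  have "(\<Sum>y\<in>F. w (\<tau> y)) = (\<Sum>y\<in>F. \<Sum>m\<in>\<tau> ` F. w m * of_bool (\<tau> y = m))"
    using F by (intro sum.cong) (auto simp: of_bool_def if_distrib cong: if_cong)
  also have "\<dots> = (\<Sum>m\<in>\<tau> ` F. w m * (\<Sum>y\<in>F. of_bool (\<tau> y = m)))"
    by (subst sum.swap) (simp add: sum_distrib_left)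
  also have "\<dots> \<le> (\<Sum>m\<in>\<tau> ` F. w m * R)"
    using w sum_fibre_le[OF \<Gamma> F \<tau>] by (intro sum_mono mult_left_mono) auto
  also have "\<dots> = R * (\<Sum>m\<in>\<tau> ` F. w m)" by (simp add: sum_distrib_left mult.commute)
  also have "\<dots> \<le> R * (\<Sum>\<^sub>\<infinity>m. w m)"
    using w F R by (intro mult_left_mono finite_sum_le_infsum) auto
  finally show ?thesis .
qed

lemma norm_diff_same_cell_translates:
  "cell (x - y) = cell (x - z) \<Longrightarrow> norm (y - z) < 1"
  "cell (y - x) = cell (z - x) \<Longrightarrow> norm (y - z) < 1"
  using norm_diff_same_cell[of "x - y" "x - z"] norm_diff_same_cell[of "y - x" "z - x"]
  by (simp_all add: norm_minus_commute)

lemma summable_convolution: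
  fixes \<Gamma> :: "(real ^ 'n) set" and s :: "int ^ 'n \<Rightarrow> real"
  assumes \<Gamma>: "at_most_per_ball R \<Gamma>" and s: "\<And>m. 0 \<le> s m" "s summable_on UNIV"
    and g: "\<And>m y. y \<in> \<Gamma> \<Longrightarrow> \<bar>g m y\<bar> \<le> B"
  shows "(\<lambda>y. s (cell (x - y)) * \<bar>g (cell (x - y)) y\<bar>) summable_on \<Gamma>"
proof -
  have "(\<lambda>y. s (cell (x - y))) summable_on \<Gamma>"
    by (rule nonneg_summable_infsum_le(1)[where B = "R * (\<Sum>\<^sub>\<infinity>m. s m)"])
      (use s in \<open>auto intro!: sum_weight_le[OF \<Gamma>] dest: norm_diff_same_cell_translates\<close>)
  then have "(\<lambda>y. s (cell (x - y)) * B) summable_on \<Gamma>" by (rule summable_on_cmult_left)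
  then show ?thesis
    by (rule summable_on_comparison_test) (use s g in \<open>auto intro: mult_left_mono\<close>)
qed

text \<open>
  A kernel dominated by a summable function of the cell of \<open>x - y\<close> acts on \<open>\<ell>\<^sup>p\<close>. It is split into
  its side-diagonals, one for each cell \<open>m\<close>: a side-diagonal has at most \<open>R\<close> entries in each row and in each
  column, so the Schur test applies to it, and Minkowski's inequality adds the pieces. The function \<open>g\<close>
  may depend on the side-diagonal, as it does for commutators.
\<close>

lemma lp_bound_convolution:
  fixes \<Gamma> \<Lambda> :: "(real ^ 'n) set"
  assumes p: "1 \<le> p" and \<Gamma>: "at_most_per_ball R \<Gamma>" and \<Lambda>: "at_most_per_ball R \<Lambda>"
    and s: "\<And>m. 0 \<le> s m" "s summable_on UNIV"
    and g: "\<And>m. lp_bound p \<Gamma> (g m) (B m)" and B: "\<And>m. B m \<le> B0"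
    and f: "\<And>x. x \<in> \<Lambda> \<Longrightarrow> \<bar>f x\<bar> \<le> (\<Sum>\<^sub>\<infinity>y\<in>\<Gamma>. s (cell (x - y)) * \<bar>g (cell (x - y)) y\<bar>)"
  shows "lp_bound p \<Lambda> f (R * (\<Sum>\<^sub>\<infinity>m. s m * B m))"
proof -
  have R: "0 \<le> R"
    using \<Gamma> by (rule at_most_per_ball_nonneg)
  have B_nonneg: "0 \<le> B m" for m using lp_bound_nonneg[OF g] .
  have gB: "\<bar>g m y\<bar> \<le> B0" if "y \<in> \<Gamma>" for m y
    using lp_bound_pointwise[OF p g[of m] that] B[of m] by linarith
  define G where "G = (\<lambda>m x. \<Sum>\<^sub>\<infinity>y\<in>\<Gamma>. of_bool (cell (x - y) = m) * \<bar>g m y\<bar>)"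
  have G0: "0 \<le> G m x" for m x unfolding G_def by (auto intro: infsum_nonneg)
  have G: "lp_bound p \<Lambda> (G m) (R * B m)" for m
  proof (rule schur_test[OF p g R])
    show "\<bar>G m x\<bar> \<le> (\<Sum>\<^sub>\<infinity>y\<in>\<Gamma>. of_bool (cell (x - y) = m) * \<bar>g m y\<bar>)" for x
      using G0[of m x] by (simp add: G_def)
    show "(\<Sum>y\<in>F. of_bool (cell (x - y) = m)) \<le> R" if "finite F" "F \<subseteq> \<Gamma>" for x F
      using sum_fibre_le[OF \<Gamma> that, of "\<lambda>y. cell (x - y)"] norm_diff_same_cell_translates by blast
    show "(\<Sum>x\<in>F. of_bool (cell (x - y) = m)) \<le> R" if "finite F" "F \<subseteq> \<Lambda>" for y F
      using sum_fibre_le[OF \<Lambda> that, of "\<lambda>x. cell (x - y)"] norm_diff_same_cell_translates by blast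
  qed auto
  have sB: "(\<lambda>m. s m * (R * B m)) summable_on UNIV"
  proof (rule summable_on_comparison_test[OF summable_on_cmult_left[OF s(2), of "R * B0"]])
  qed (use s B R B_nonneg in \<open>auto intro!: mult_left_mono mult_nonneg_nonneg\<close>)
  have "lp_bound p \<Lambda> f (\<Sum>\<^sub>\<infinity>m. s m * (R * B m))"
  proof (rule lp_bound_infsum[OF p _ sB])
    show "lp_bound p \<Lambda> (\<lambda>x. s m * G m x) (s m * (R * B m))" for m
      using lp_bound_scale[OF p G, of "s m" m] s by simp
    fix x assume x: "x \<in> \<Lambda>"
    have GR: "G m x \<le> R * B m" for m
      using lp_bound_pointwise[OF p G[of m] x] G0[of m x] by simp
    have sG: "(\<lambda>m. s m * G m x) summable_on UNIV"
      by (rule summable_on_comparison_test[OF sB])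
        (use s GR G0 in \<open>auto intro: mult_left_mono\<close>)
    have sg: "(\<lambda>y. of_bool (cell (x - y) = m) * \<bar>g m y\<bar>) summable_on \<Gamma>" for m
    proof -
      have "(\<lambda>y. of_bool (cell (x - y) = m) * \<bar>(\<lambda>_. g m) (cell (x - y)) y\<bar>) summable_on \<Gamma>"
        by (rule summable_convolution[OF \<Gamma>, of "\<lambda>j. of_bool (j = m)"])
          (use gB in \<open>auto simp: of_bool_def intro: nonneg_summable_infsum_le(1)[where B = 1]\<close>)
      then show ?thesis by simp
    qed
    have "\<bar>f x\<bar> \<le> (\<Sum>\<^sub>\<infinity>y\<in>\<Gamma>. s (cell (x - y)) * \<bar>g (cell (x - y)) y\<bar>)" by (rule f[OF x])
    also have "\<dots> \<le> (\<Sum>\<^sub>\<infinity>m. s m * G m x)"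
    proof (rule infsum_le_finite_sums[OF summable_convolution[OF \<Gamma> s gB]])
      fix F assume F: "finite F" "F \<subseteq> \<Gamma>"
      define T where "T = (\<lambda>y. cell (x - y)) ` F"
      have T: "finite T" using F by (simp add: T_def)
      have "(\<Sum>y\<in>F. s (cell (x - y)) * \<bar>g (cell (x - y)) y\<bar>)
          = (\<Sum>y\<in>F. \<Sum>m\<in>T. s m * (of_bool (cell (x - y) = m) * \<bar>g m y\<bar>))"
      proof (rule sum.cong[OF refl])
        fix y assume "y \<in> F"
        then have m: "cell (x - y) \<in> T" by (simp add: T_def)
        have "(\<Sum>m\<in>T. s m * (of_bool (cell (x - y) = m) * \<bar>g m y\<bar>))
            = (\<Sum>m\<in>T. if m = cell (x - y) then s m * \<bar>g m y\<bar> else 0)"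
          by (intro sum.cong) auto
        also have "\<dots> = s (cell (x - y)) * \<bar>g (cell (x - y)) y\<bar>" using T m by simp
        finally show "s (cell (x - y)) * \<bar>g (cell (x - y)) y\<bar>
          = (\<Sum>m\<in>T. s m * (of_bool (cell (x - y) = m) * \<bar>g m y\<bar>))" ..
      qed
      also have "\<dots> = (\<Sum>m\<in>T. s m * (\<Sum>y\<in>F. of_bool (cell (x - y) = m) * \<bar>g m y\<bar>))"
        by (subst sum.swap) (simp add: sum_distrib_left)
      also have "\<dots> \<le> (\<Sum>m\<in>T. s m * G m x)"
        using s F sg unfolding G_def by (intro sum_mono mult_left_mono finite_sum_le_infsum) auto
      also have "\<dots> \<le> (\<Sum>\<^sub>\<infinity>m. s m * G m x)"
        using T s G0 sG by (intro finite_sum_le_infsum) auto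
      finally show "(\<Sum>y\<in>F. s (cell (x - y)) * \<bar>g (cell (x - y)) y\<bar>) \<le> (\<Sum>\<^sub>\<infinity>m. s m * G m x)" .
    qed
    also have "\<dots> = (\<Sum>\<^sub>\<infinity>m. \<bar>s m * G m x\<bar>)" using s G0 by simp
    finally show "\<bar>f x\<bar> \<le> (\<Sum>\<^sub>\<infinity>m. \<bar>s m * G m x\<bar>)" .
  qed
  also have "(\<Sum>\<^sub>\<infinity>m. s m * (R * B m)) = R * (\<Sum>\<^sub>\<infinity>m. s m * B m)"
    by (subst infsum_cmult_right'[symmetric]) (simp add: mult.left_commute)
  finally show ?thesis .
qed

section \<open>Exponential weights\<close>

text \<open>
  The weights that localise. They decay exponentially instead of having compact support: moving the
  argument by about \<open>node m\<close> then amounts to moving the centre by \<open>- m\<close>, up to a constant factor, whereas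
  supports of cut-off functions would have to be covered by translates.
\<close>

definition bump :: "real \<Rightarrow> int ^ 'n \<Rightarrow> real ^ 'n \<Rightarrow> real" where
  "bump N k x = exp (- norm (x - node k) / N)"

lemma bump_pos: "0 < bump N k x"
  by (simp add: bump_def)

lemma bump_le_1: "0 \<le> N \<Longrightarrow> bump N k x \<le> 1"
  by (simp add: bump_def)

text \<open>
  The difference of two values of the exponential is controlled by the values themselves; this keeps
  the commutator localised.
\<close>

lemma abs_diff_exp_le:
  fixes a b :: real
  shows "\<bar>exp (- a) - exp (- b)\<bar> \<le> min 1 \<bar>a - b\<bar> * (exp (- a) + exp (- b))"
proof -
  have *: "\<bar>exp (- a) - exp (- b)\<bar> \<le> min 1 \<bar>a - b\<bar> * (exp (- a) + exp (- b))" if "a \<le> b"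
    for a b :: real
  proof -
    have eq: "exp (- a) - exp (- b) = exp (- a) * (1 - exp (- (b - a)))"
      by (simp add: right_diff_distrib flip: exp_add)
    have "1 - exp (- (b - a)) \<le> min 1 \<bar>a - b\<bar>"
      using exp_ge_add_one_self[of "- (b - a)"] exp_gt_zero[of "- (b - a)"] that
      unfolding min_def abs_if by argo
    then have "exp (- a) * (1 - exp (- (b - a))) \<le> exp (- a) * min 1 \<bar>a - b\<bar>"
      by (rule mult_left_mono) simp
    also have "\<dots> \<le> min 1 \<bar>a - b\<bar> * (exp (- a) + exp (- b))"
      by (simp add: distrib_left mult.commute)
    finally show ?thesis using that by (simp add: eq)
  qed
  show ?thesis
    using *[of a b] *[of b a] by (cases "a \<le> b") (auto simp: abs_minus_commute add.commute)
qed

text \<open>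
  Since \<open>x - y\<close> is within distance \<open>1\<close> of \<open>node (cell (x - y))\<close>, the two exponents differ by at most
  \<open>1 / N \<le> 1\<close>, and \<open>exp 1 \<le> 3\<close>.
\<close>

lemma bump_shift:
  assumes "1 \<le> N"
  shows "bump N k x \<le> 3 * bump N (k - cell (x - y)) y"
proof -
  define m where "m = cell (x - y)"
  have "norm (y - node (k - m)) \<le> norm (x - node k) + norm (x - y - node m)"
    by (rule order_trans[OF _ norm_triangle_ineq4]) (simp add: node_diff algebra_simps)
  then have "norm (y - node (k - m)) \<le> norm (x - node k) + 1"
    using norm_diff_node_cell[of "x - y"] by (simp add: m_def)
  then have "norm (y - node (k - m)) / N \<le> (norm (x - node k) + 1) / N"
    using assms by (intro divide_right_mono) auto
  also have "\<dots> \<le> norm (x - node k) / N + 1"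
    using assms by (simp add: add_divide_distrib)
  finally have "bump N k x \<le> exp (1 + - norm (y - node (k - m)) / N)"
    by (simp add: bump_def)
  also have "\<dots> = exp 1 * bump N (k - m) y"
    by (simp only: exp_add bump_def)
  also have "\<dots> \<le> 3 * bump N (k - m) y"
    using exp_le bump_pos[of N "k - m" y] by (intro mult_right_mono) auto
  finally show ?thesis by (simp add: m_def)
qed

lemma bump_cell:
  assumes "1 \<le> N"
  shows "1 \<le> 3 * bump N (cell x) x"
proof -
  have "norm (x - node (cell x)) / N \<le> 1"
    using norm_diff_node_cell[of x] assms by (simp add: divide_le_eq)
  then have "exp (- 1) \<le> bump N (cell x) x" by (simp add: bump_def)
  moreover have "1 \<le> 3 * exp (- 1 :: real)"
    using exp_le by (simp add: exp_minus field_simps)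
  ultimately show ?thesis by linarith
qed

text \<open>
  The Euclidean norm dominates the \<open>\<ell>\<^sup>1\<close> norm divided by the dimension, which turns the sum into a product
  of geometric series.
\<close>

lemma summable_bump:
  assumes "0 < N"
  shows "(\<lambda>k. bump N k (0 :: real ^ 'n)) summable_on UNIV"
proof -
  define D where "D = real CARD('n)"
  define t where "t = 1 / (D * (D + 1) * N)"
  have D: "0 < D" by (simp add: D_def)
  then have t: "0 < t" using assms by (simp add: t_def)
  define g where "g = (\<lambda>j::int. exp (- t * \<bar>real_of_int j\<bar>))"
  have nat: "summable (\<lambda>n. exp (- t * real n))"
    using summable_geometric[of "exp (- t)"] t
    by (simp add: exp_of_nat_mult[symmetric] mult.commute)
  define G where "G = 2 * (\<Sum>n. exp (- t * real n))"
  have gF: "(\<Sum>j\<in>J. g j) \<le> G" if \<open>finite J\<close> for J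
  proof -
    obtain n where n: "\<And>j. j \<in> J \<Longrightarrow> nat \<bar>j\<bar> < n"
      using finite_nat_set_iff_bounded[of "(\<lambda>j. nat \<bar>j\<bar>) ` J"] finite_imageI[OF \<open>finite J\<close>] by blast
    have "(\<Sum>j\<in>J. g j) \<le> (\<Sum>j\<in>int ` {..<n} \<union> (\<lambda>i. - int i) ` {..<n}. g j)"
    proof (rule sum_mono2)
      show "J \<subseteq> int ` {..<n} \<union> (\<lambda>i. - int i) ` {..<n}"
      proof
        fix j assume j: "j \<in> J"
        show "j \<in> int ` {..<n} \<union> (\<lambda>i. - int i) ` {..<n}"
        proof (cases "0 \<le> j")
          case True
          then have "j = int (nat \<bar>j\<bar>)" by simp
          then show ?thesis using n[OF j] by blast
        next
          case False
          then have "j = - int (nat \<bar>j\<bar>)" by simp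
          then show ?thesis using n[OF j] by blast
        qed
      qed
    qed (auto simp: g_def)
    also have "\<dots> \<le> (\<Sum>j\<in>int ` {..<n}. g j) + (\<Sum>j\<in>(\<lambda>i. - int i) ` {..<n}. g j)"
      by (subst sum_Un) (auto simp: g_def intro: sum_nonneg)
    also have "\<dots> = 2 * (\<Sum>i<n. exp (- t * real i))"
      by (simp add: sum.reindex inj_on_def g_def)
    also have "\<dots> \<le> G" using nat unfolding G_def
      by (intro mult_left_mono sum_le_suminf) auto
    finally show ?thesis .
  qed
  have G0: "0 \<le> G" using gF[of "{}"] by simp
  have le: "bump N k 0 \<le> (\<Prod>i\<in>UNIV. g (k $ i))" for k :: "int ^ 'n"
  proof -
    have "(\<Sum>i\<in>UNIV. \<bar>real_of_int (k $ i)\<bar>) / (D + 1) = (\<Sum>i\<in>UNIV. \<bar>node k $ i\<bar>)"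
      by (simp add: node_def D_def sum_divide_distrib)
    also have "\<dots> \<le> (\<Sum>i\<in>(UNIV :: 'n set). norm (node k))"
      by (intro sum_mono component_le_norm_cart)
    also have "\<dots> = D * norm (node k)" by (simp add: D_def)
    finally have "(\<Sum>i\<in>UNIV. \<bar>real_of_int (k $ i)\<bar>) / (D + 1) / (D * N) \<le> D * norm (node k) / (D * N)"
      using D assms by (intro divide_right_mono) auto
    then have "t * (\<Sum>i\<in>UNIV. \<bar>real_of_int (k $ i)\<bar>) \<le> norm (node k) / N"
      using D by (simp add: t_def mult.commute mult.left_commute)
    then have "bump N k 0 \<le> exp (\<Sum>i\<in>UNIV. - t * \<bar>real_of_int (k $ i)\<bar>)"
      by (simp add: bump_def sum_negf sum_distrib_left)
    then show ?thesis by (simp add: exp_sum g_def)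
  qed
  show ?thesis
  proof (rule nonneg_summable_infsum_le(1))
    show "0 \<le> bump N k 0" for k :: "int ^ 'n" using bump_pos[of N k 0] by simp
    fix F :: "(int ^ 'n) set" assume F: "finite F"
    define J where "J = (\<Union>k\<in>F. range (\<lambda>i. k $ i))"
    have J: "finite J" using F by (simp add: J_def)
    have "(\<Sum>k\<in>F. bump N k 0) \<le> (\<Sum>k\<in>F. \<Prod>i\<in>UNIV. g (k $ i))"
      by (intro sum_mono le)
    also have "\<dots> = (\<Sum>f\<in>vec_nth ` F. \<Prod>i\<in>UNIV. g (f i))"
      by (subst sum.reindex) (auto simp: inj_on_def vec_nth_inject)
    also have "\<dots> \<le> (\<Sum>f\<in>PiE UNIV (\<lambda>_::'n. J). \<Prod>i\<in>UNIV. g (f i))"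
      using J by (intro sum_mono2 finite_PiE) (auto simp: J_def g_def intro: prod_nonneg)
    also have "\<dots> = (\<Prod>i\<in>(UNIV::'n set). \<Sum>j\<in>J. g j)"
      using J by (subst prod_sum_PiE) auto
    also have "\<dots> \<le> (\<Prod>i\<in>(UNIV::'n set). G)"
      using gF[OF J] by (intro prod_mono) (auto simp: g_def intro: sum_nonneg)
    finally show "(\<Sum>k\<in>F. bump N k 0) \<le> (\<Prod>i\<in>(UNIV::'n set). G)" .
  qed
qed

section \<open>The envelope\<close>

text \<open>
  A continuous function exceeding the essential supremum at one point would do so on an open box,
  and a nonempty open box has positive measure.
\<close>

lemma abs_le_Linf_norm_ball:
  fixes f :: "real ^ 'n \<Rightarrow> real"
  assumes f: "continuous_on UNIV f" and y: "y \<in> ball x 1"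
  shows "ennreal \<bar>f y\<bar> \<le> Linf_norm (ball x 1) f"
proof (rule ccontr)
  assume "\<not> ennreal \<bar>f y\<bar> \<le> Linf_norm (ball x 1) f"
  then have less: "Linf_norm (ball x 1) f < ennreal \<bar>f y\<bar>" by simp
  then have "Linf_norm (ball x 1) f < top" using less_trans ennreal_less_top by blast
  then obtain g where g: "0 \<le> g" "Linf_norm (ball x 1) f = ennreal g"
    by (cases "Linf_norm (ball x 1) f") auto
  have "open (ball x 1 \<inter> {z. g < \<bar>f z\<bar>})"
    using f by (intro open_Int open_ball open_Collect_less continuous_intros) auto
  moreover have "y \<in> ball x 1 \<inter> {z. g < \<bar>f z\<bar>}"
    using y less g by (simp add: ennreal_less_iff)
  ultimately obtain e where e: "0 < e" "ball y e \<subseteq> ball x 1 \<inter> {z. g < \<bar>f z\<bar>}"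
    using open_contains_ball by blast
  obtain a b where ab: "y \<in> box a b" "box a b \<subseteq> ball y e"
    using rational_boxes[OF e(1), of y] by blast
  have "AE z in lebesgue_on (ball x 1). ennreal \<bar>f z\<bar> \<le> ennreal g"
    using esssup_AE[of "\<lambda>z. ennreal \<bar>f z\<bar>" "lebesgue_on (ball x 1)"] g(2)
    by (simp add: Linf_norm_def)
  then have "AE z in lebesgue. z \<in> ball x 1 \<longrightarrow> ennreal \<bar>f z\<bar> \<le> ennreal g"
    by (subst (asm) AE_restrict_space_iff) auto
  then have "AE z in lebesgue. z \<notin> box a b"
  proof (rule AE_mp, intro AE_I2 impI notI)
    fix z assume z: "z \<in> ball x 1 \<longrightarrow> ennreal \<bar>f z\<bar> \<le> ennreal g" "z \<in> box a b"
    then have "z \<in> ball x 1" "g < \<bar>f z\<bar>" using ab e by auto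
    then show False using z g by (simp add: ennreal_le_iff2)
  qed
  then have "emeasure lebesgue (box a b) = 0"
    by (subst (asm) AE_iff_null_sets[symmetric]) auto
  then have "emeasure lborel (box a b) = 0" by simp
  moreover have "emeasure lborel (box a b) = ennreal (\<Prod>i\<in>Basis. (b - a) \<bullet> i)"
    using ab(1) unfolding mem_box by (intro emeasure_lborel_box) (meson less_trans less_imp_le)
  moreover have "0 < (\<Prod>i\<in>Basis. (b - a) \<bullet> i)"
    using ab(1) unfolding mem_box inner_diff_left
    by (intro prod_pos) (metis diff_gt_0_iff_gt less_trans)
  ultimately show False by (metis ennreal_eq_0_iff not_less)
qed

text \<open>
  For \<open>x\<close> in a cell, the supremum of \<open>\<bar>\<Theta>\<bar>\<close> over the cell is at most the essential supremum over the unit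
  ball around \<open>x\<close>. Integrating this over \<open>x\<close> bounds the sum of the suprema by a multiple of the amalgam
  norm. From here on, \<open>\<Theta>\<close> enters only through the summable sequence \<open>S\<close>.
\<close>

lemma W_C0_L1_summable_envelope:
  fixes \<Theta> :: "real ^ 'n \<Rightarrow> real"
  assumes "\<Theta> \<in> W_C0_L1"
  obtains S where "\<And>m. 0 \<le> S m" "S summable_on UNIV" "\<And>x. \<bar>\<Theta> x\<bar> \<le> S (cell x)"
proof -
  define G where "G = (\<lambda>x. Linf_norm (ball x 1) \<Theta>)"
  have cont: "continuous_on UNIV \<Theta>" and fin: "(\<integral>\<^sup>+x. G x \<partial>lebesgue) < \<infinity>"
    using assms by (auto simp: W_C0_L1_def W_Linf_L1_def G_def)
  define T where "T = (\<lambda>m. SUP y\<in>{y. cell y = m}. ennreal \<bar>\<Theta> y\<bar>)"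
  have T: "ennreal \<bar>\<Theta> x\<bar> \<le> T (cell x)" for x
    unfolding T_def by (rule SUP_upper) simp
  have TG: "T (cell x) \<le> G x" for x
    unfolding T_def G_def
    by (rule SUP_least) (auto intro!: abs_le_Linf_norm_ball[OF cont] simp: dist_norm norm_diff_same_cell)
  define v where "v = (\<Prod>b\<in>Basis. node (1 :: int ^ 'n) \<bullet> b)"
  have node1: "0 < node (1 :: int ^ 'n) \<bullet> b" if "b \<in> Basis" for b
    using that by (auto simp: Basis_vec_def inner_axis node_def)
  have v: "0 < v" unfolding v_def using node1 by (intro prod_pos) auto
  \<comment> \<open>Open boxes inside the cells, all of volume \<open>v\<close>; here \<open>1\<close> is the vector of ones.\<close>
  define Q where "Q = (\<lambda>m :: int ^ 'n. box (node m) (node (m + 1)))"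
  have Q_measure: "emeasure lebesgue (Q m) = ennreal v" for m
    using node1 by (simp add: Q_def emeasure_lborel_box_eq node_add inner_add_left less_imp_le v_def)
  have Q_cell: "cell x = m" if "x \<in> Q m" for x m
  proof -
    have "node m $ i < x $ i \<and> x $ i < node (m + 1) $ i" for i
      using that by (simp add: Q_def mem_box_cart)
    then have "\<lfloor>x $ i * (real CARD('n) + 1)\<rfloor> = m $ i" for i
      by (intro floor_unique) (simp_all add: node_def pos_divide_less_eq pos_less_divide_eq less_imp_le)
    then show ?thesis by (simp add: cell_def vec_eq_iff)
  qed
  have int: "(\<Sum>m\<in>F. T m * ennreal v) \<le> (\<integral>\<^sup>+x. G x \<partial>lebesgue)" if F: "finite F" for F
  proof -
    have "(\<Sum>m\<in>F. T m * ennreal v) = (\<Sum>m\<in>F. \<integral>\<^sup>+x. T m * indicator (Q m) x \<partial>lebesgue)"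
      by (intro sum.cong refl, subst nn_integral_cmult_indicator) (auto simp: Q_measure, simp add: Q_def)
    also have "\<dots> = (\<integral>\<^sup>+x. (\<Sum>m\<in>F. T m * indicator (Q m) x) \<partial>lebesgue)"
      by (rule nn_integral_sum[symmetric]) (auto simp: Q_def intro!: borel_measurable_times_ennreal borel_measurable_indicator)
    also have "\<dots> \<le> (\<integral>\<^sup>+x. G x \<partial>lebesgue)"
    proof (rule nn_integral_mono)
      fix x
      have "(\<Sum>m\<in>F. T m * indicator (Q m) x) \<le> (\<Sum>m\<in>F. if m = cell x then T m else 0)"
      proof (rule sum_mono)
        show "T m * indicator (Q m) x \<le> (if m = cell x then T m else 0)" for m
          by (cases "x \<in> Q m") (auto dest: Q_cell)
      qed
      also have "\<dots> \<le> T (cell x)" using F by simp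
      also have "\<dots> \<le> G x" by (rule TG)
      finally show "(\<Sum>m\<in>F. T m * indicator (Q m) x) \<le> G x" .
    qed
    finally show ?thesis .
  qed
  obtain i where i: "0 \<le> i" "(\<integral>\<^sup>+x. G x \<partial>lebesgue) = ennreal i"
    using fin by (cases "\<integral>\<^sup>+x. G x \<partial>lebesgue") auto
  have "T m < top" for m
  proof (rule ccontr)
    assume "\<not> T m < top"
    then have "T m * ennreal v = top" using v by (simp add: less_top[symmetric] ennreal_top_mult)
    then show False using int[of "{m}"] i(2) by (simp add: top_unique)
  qed
  then have TS: "T m = ennreal (enn2real (T m))" for m by simp
  have bound: "(\<Sum>m\<in>F. enn2real (T m)) \<le> i / v" if F: "finite F" for F
  proof -
    have "ennreal (\<Sum>m\<in>F. enn2real (T m) * v) = (\<Sum>m\<in>F. T m * ennreal v)"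
      using v TS by (subst sum_ennreal[symmetric]) (auto simp: ennreal_mult)
    also have "\<dots> \<le> ennreal i" using int[OF F] i by simp
    finally have "(\<Sum>m\<in>F. enn2real (T m)) * v \<le> i" using i by (simp add: sum_distrib_right)
    then show ?thesis using v by (simp add: pos_le_divide_eq)
  qed
  show thesis
  proof (rule that)
    show "(\<lambda>m. enn2real (T m)) summable_on UNIV"
      by (rule nonneg_summable_infsum_le(1)) (use bound in auto)
    show "\<bar>\<Theta> x\<bar> \<le> enn2real (T (cell x))" for x
      using T[of x] TS[of "cell x"] by (metis enn2real_nonneg ennreal_le_iff)
  qed simp
qed

section \<open>Matrices with an envelope and their commutators with weights\<close>

text \<open>
  For \<open>N > 0\<close>, an upper bound for \<open>min 1 (norm z / N)\<close> over all \<open>z\<close> with \<open>cell z = m\<close>: such \<open>z\<close> are within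
  distance \<open>1\<close> of \<open>node m\<close>.
\<close>

definition modulus :: "real \<Rightarrow> int ^ 'n \<Rightarrow> real" where
  "modulus N m = min 1 ((norm (node m) + 1) / N)"

lemma modulus_bounds: "0 < N \<Longrightarrow> 0 \<le> modulus N m" "modulus N m \<le> 1"
  by (auto simp: modulus_def)

lemma summable_modulus:
  assumes S: "\<And>m. 0 \<le> S m" "S summable_on UNIV" and "0 < N"
  shows "(\<lambda>m. S m * modulus N m) summable_on UNIV"
  by (rule summable_on_comparison_test[OF S(2)])
    (use S modulus_bounds[of N] assms(3) in \<open>auto intro: mult_left_le mult_nonneg_nonneg\<close>)

text \<open>
  Dominated convergence: \<open>modulus N m \<le> 1\<close> handles the tail of \<open>S\<close>, and \<open>modulus N m \<longrightarrow> 0\<close> as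
  \<open>N \<longrightarrow> \<infinity>\<close> handles the finitely many remaining terms.
\<close>

lemma modulus_sum_small:
  fixes S :: "int ^ 'n \<Rightarrow> real"
  assumes S: "\<And>m. 0 \<le> S m" "S summable_on UNIV" and \<epsilon>: "0 < \<epsilon>"
  obtains N where "1 \<le> N" "(\<Sum>\<^sub>\<infinity>m. S m * modulus N m) \<le> \<epsilon>"
proof -
  obtain F where F: "finite F" "dist (sum S F) (infsum S UNIV) \<le> \<epsilon> / 2"
    using infsum_finite_approximation[OF S(2), of "\<epsilon> / 2"] \<epsilon> by auto
  \<comment> \<open>Outside \<open>F\<close> at most \<open>\<epsilon> / 2\<close> of the mass of \<open>S\<close> is left;
      \<open>N\<close> is chosen to make the part over \<open>F\<close> small.\<close>
  define K where "K = (\<Sum>m\<in>F. S m * (norm (node m) + 1))"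
  define N where "N = max 1 (2 * K / \<epsilon>)"
  have N: "1 \<le> N" "K / N \<le> \<epsilon> / 2"
  proof -
    show "1 \<le> N" by (simp add: N_def)
    have "2 * K / \<epsilon> \<le> N" by (simp add: N_def)
    then show "K / N \<le> \<epsilon> / 2" using \<epsilon> \<open>1 \<le> N\<close> by (simp add: field_simps)
  qed
  have "(\<Sum>\<^sub>\<infinity>m. S m * modulus N m) \<le> \<epsilon>"
  proof (rule infsum_le_finite_sums[OF summable_modulus[OF S]])
    fix E :: "(int ^ 'n) set" assume E: "finite E"
    have "(\<Sum>m\<in>E. S m * modulus N m) \<le> (\<Sum>m\<in>F \<union> (E - F). S m * modulus N m)"
      using E F S modulus_bounds[of N] N by (intro sum_mono2) (auto intro!: mult_nonneg_nonneg)
    also have "\<dots> = (\<Sum>m\<in>F. S m * modulus N m) + (\<Sum>m\<in>E - F. S m * modulus N m)"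
      using E F by (intro sum.union_disjoint) auto
    also have "(\<Sum>m\<in>F. S m * modulus N m) \<le> (\<Sum>m\<in>F. S m * ((norm (node m) + 1) / N))"
      using S by (intro sum_mono mult_left_mono) (auto simp: modulus_def)
    also have "\<dots> = K / N" by (simp add: K_def sum_divide_distrib)
    also have "(\<Sum>m\<in>E - F. S m * modulus N m) \<le> (\<Sum>m\<in>E - F. S m)"
      using S modulus_bounds[of N] N by (intro sum_mono mult_left_le) auto
    also have "\<dots> = sum S (E \<union> F) - sum S F"
    proof -
      have "sum S ((E - F) \<union> F) = sum S (E - F) + sum S F"
        using E F by (intro sum.union_disjoint) auto
      then show ?thesis by simp
    qed
    also have "\<dots> \<le> infsum S UNIV - sum S F"
      using E F S by (intro diff_right_mono finite_sum_le_infsum) auto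
    also have "\<dots> \<le> \<epsilon> / 2" using F(2) unfolding dist_real_def by linarith
    also have "K / N + \<epsilon> / 2 \<le> \<epsilon>" using N(2) by linarith
    finally show "(\<Sum>m\<in>E. S m * modulus N m) \<le> \<epsilon>" by simp
  qed (use N in simp)
  with N show thesis by (intro that)
qed

lemma bump_diff_le:
  assumes N: "1 \<le> N"
  shows "\<bar>bump N k y - bump N k x\<bar>
    \<le> modulus N (cell (x - y)) * (bump N k y + 3 * bump N (k - cell (x - y)) y)"
proof -
  have "\<bar>norm (y - node k) / N - norm (x - node k) / N\<bar> \<le> norm (x - y) / N"
    using N norm_triangle_ineq3[of "y - node k" "x - node k"]
    by (simp add: diff_divide_distrib[symmetric] divide_right_mono norm_minus_commute)
  also have "\<dots> \<le> (norm (node (cell (x - y))) + 1) / N"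
    using N norm_diff_node_cell[of "x - y"] norm_triangle_sub[of "x - y" "node (cell (x - y))"]
    by (intro divide_right_mono) auto
  finally have "min 1 \<bar>norm (y - node k) / N - norm (x - node k) / N\<bar> \<le> modulus N (cell (x - y))"
    by (auto simp: modulus_def)
  moreover have "\<bar>bump N k y - bump N k x\<bar>
      \<le> min 1 \<bar>norm (y - node k) / N - norm (x - node k) / N\<bar> * (bump N k y + bump N k x)"
    using abs_diff_exp_le[of "norm (y - node k) / N" "norm (x - node k) / N"]
    by (simp add: bump_def)
  moreover have "bump N k x \<le> 3 * bump N (k - cell (x - y)) y" by (rule bump_shift[OF N])
  ultimately show ?thesis
    using bump_pos[of N k y] bump_pos[of N k x] modulus_bounds(1)[of N "cell (x - y)"] N
    by (smt (verit, ccfv_threshold) mult_left_mono mult_right_mono)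
qed

lemma norm_infsum_le_dominated:
  fixes f :: "'a \<Rightarrow> 'b :: banach"
  assumes g: "g summable_on A" and fg: "\<And>x. x \<in> A \<Longrightarrow> norm (f x) \<le> g x"
  shows "f summable_on A" "norm (infsum f A) \<le> infsum g A"
proof -
  have f: "f abs_summable_on A"
    by (rule summable_on_comparison_test[OF g]) (use fg in auto)
  then show "f summable_on A" by (rule abs_summable_summable)
  have "norm (infsum f A) \<le> (\<Sum>\<^sub>\<infinity>x\<in>A. norm (f x))" by (rule norm_infsum_bound[OF f])
  also have "\<dots> \<le> infsum g A" using f g fg by (rule infsum_mono)
  finally show "norm (infsum f A) \<le> infsum g A" .
qed

lemma row_summable:
  fixes s :: "int ^ 'n \<Rightarrow> real"
  assumes \<Gamma>: "at_most_per_ball R \<Gamma>" and s: "\<And>m. 0 \<le> s m" "s summable_on UNIV"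
  shows "(\<lambda>y. s (cell (x - y))) summable_on \<Gamma>"
  using summable_convolution[OF \<Gamma> s, of "\<lambda>_ _. 1" 1 x] by simp

lemma matrix_row_summable:
  fixes M :: "real ^ 'n \<Rightarrow> complex"
  assumes \<Gamma>: "at_most_per_ball R \<Gamma>" and s: "\<And>m. 0 \<le> s m" "s summable_on UNIV"
    and M: "\<And>y. y \<in> \<Gamma> \<Longrightarrow> norm (M y) \<le> s (cell (x - y))"
    and c: "\<And>y. y \<in> \<Gamma> \<Longrightarrow> norm (c y) \<le> B"
  shows "(\<lambda>y. M y * c y) summable_on \<Gamma>"
proof (rule norm_infsum_le_dominated(1))
  show "(\<lambda>y. s (cell (x - y)) * B) summable_on \<Gamma>"
    by (intro summable_on_cmult_left row_summable[OF \<Gamma> s])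
  show "norm (M y * c y) \<le> s (cell (x - y)) * B" if "y \<in> \<Gamma>" for y
    using M[OF that] c[OF that] s by (simp add: norm_mult mult_mono)
qed

lemma lp_bound_mat_apply:
  fixes M :: "real ^ 'n \<Rightarrow> real ^ 'n \<Rightarrow> complex"
  assumes p: "1 \<le> p" and \<Gamma>: "at_most_per_ball R \<Gamma>" and \<Lambda>: "at_most_per_ball R \<Lambda>"
    and s: "\<And>m. 0 \<le> s m" "s summable_on UNIV"
    and M: "\<And>x y. x \<in> \<Lambda> \<Longrightarrow> y \<in> \<Gamma> \<Longrightarrow> norm (M x y) \<le> s (cell (x - y))"
    and c: "lp_bound p \<Gamma> (\<lambda>y. norm (c y)) B"
  shows "lp_bound p \<Lambda> (\<lambda>x. norm (mat_apply \<Gamma> \<Lambda> M c x)) (R * infsum s UNIV * B)"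
proof -
  have cB: "norm (c y) \<le> B" if "y \<in> \<Gamma>" for y using lp_bound_pointwise[OF p c that] by simp
  have "lp_bound p \<Lambda> (\<lambda>x. norm (mat_apply \<Gamma> \<Lambda> M c x)) (R * (\<Sum>\<^sub>\<infinity>m. s m * B))"
  proof (rule lp_bound_convolution[OF p \<Gamma> \<Lambda> s c order_refl])
    fix x assume x: "x \<in> \<Lambda>"
    have "norm (\<Sum>\<^sub>\<infinity>y\<in>\<Gamma>. M x y * c y) \<le> (\<Sum>\<^sub>\<infinity>y\<in>\<Gamma>. s (cell (x - y)) * \<bar>norm (c y)\<bar>)"
    proof (rule norm_infsum_le_dominated(2))
      show "(\<lambda>y. s (cell (x - y)) * \<bar>norm (c y)\<bar>) summable_on \<Gamma>"
        using summable_convolution[OF \<Gamma> s, of "\<lambda>_ y. norm (c y)" B] cB by simp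
    qed (use M x in \<open>auto simp: norm_mult intro: mult_right_mono\<close>)
    then show "\<bar>norm (mat_apply \<Gamma> \<Lambda> M c x)\<bar> \<le> (\<Sum>\<^sub>\<infinity>y\<in>\<Gamma>. s (cell (x - y)) * \<bar>norm (c y)\<bar>)"
      using x by (simp add: mat_apply_def)
  qed
  then show ?thesis by (simp add: infsum_cmult_left' mult.assoc)
qed

text \<open>
  The sum is the commutator of \<open>M\<close> with multiplication by \<open>bump N k\<close>, applied to \<open>c\<close>. By
  \<open>bump_diff_le\<close> its entries on the side-diagonal \<open>m\<close> are at most
  \<open>S m * modulus N m * (bump N k y + 3 * bump N (k - m) y)\<close>, so that only the local norms of \<open>c\<close> around
  \<open>k\<close> and \<open>k - m\<close> enter, with weights that are small in total when \<open>N\<close> is large.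
\<close>

lemma lp_bound_commutator:
  fixes M :: "real ^ 'n \<Rightarrow> real ^ 'n \<Rightarrow> complex"
  assumes p: "1 \<le> p" and \<Gamma>: "at_most_per_ball R \<Gamma>" and \<Lambda>: "at_most_per_ball R \<Lambda>"
    and S: "\<And>m. 0 \<le> S m" "S summable_on UNIV" and N: "1 \<le> N"
    and M: "\<And>x y. x \<in> \<Lambda> \<Longrightarrow> y \<in> \<Gamma> \<Longrightarrow> norm (M x y) \<le> S (cell (x - y))"
    and c: "\<And>j. lp_bound p \<Gamma> (\<lambda>y. bump N j y * norm (c y)) (a j)" and a: "\<And>j. a j \<le> A"
  shows "lp_bound p \<Lambda>
    (\<lambda>x. norm (\<Sum>\<^sub>\<infinity>y\<in>\<Gamma>. M x y * (complex_of_real (bump N k y - bump N k x) * c y)))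
    (R * (\<Sum>\<^sub>\<infinity>m. S m * modulus N m * (a k + 3 * a (k - m))))"
proof -
  define g where "g = (\<lambda>m y. (bump N k y + 3 * bump N (k - m) y) * norm (c y))"
  have g: "lp_bound p \<Gamma> (g m) (a k + 3 * a (k - m))" for m
  proof (rule lp_bound_add[OF p c[of k]])
    show "lp_bound p \<Gamma> (\<lambda>y. 3 * (bump N (k - m) y * norm (c y))) (3 * a (k - m))"
      using lp_bound_scale[OF p c[of "k - m"], of 3] by simp
    show "\<bar>g m y\<bar> \<le> \<bar>bump N k y * norm (c y)\<bar> + \<bar>3 * (bump N (k - m) y * norm (c y))\<bar>" for y
      by (simp add: g_def distrib_right abs_triangle_ineq mult.assoc)
  qed
  have B: "a k + 3 * a (k - m) \<le> 4 * A" for m using a[of k] a[of "k - m"] by simp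
  have s: "0 \<le> S m * modulus N m" "(\<lambda>m. S m * modulus N m) summable_on UNIV" for m
    using S N modulus_bounds(1)[of N m] summable_modulus[OF S] by auto
  show ?thesis
  proof (rule lp_bound_convolution[OF p \<Gamma> \<Lambda> s g B])
    fix x assume x: "x \<in> \<Lambda>"
    have "norm (\<Sum>\<^sub>\<infinity>y\<in>\<Gamma>. M x y * (complex_of_real (bump N k y - bump N k x) * c y))
      \<le> (\<Sum>\<^sub>\<infinity>y\<in>\<Gamma>. S (cell (x - y)) * modulus N (cell (x - y)) * \<bar>g (cell (x - y)) y\<bar>)"
    proof (rule norm_infsum_le_dominated(2))
      show "(\<lambda>y. S (cell (x - y)) * modulus N (cell (x - y)) * \<bar>g (cell (x - y)) y\<bar>) summable_on \<Gamma>"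
      proof (rule summable_convolution[OF \<Gamma> s])
        show "\<bar>g m y\<bar> \<le> 4 * A" if "y \<in> \<Gamma>" for m y
          using lp_bound_pointwise[OF p g[of m] that] B[of m] by linarith
      qed
      fix y assume y: "y \<in> \<Gamma>"
      let ?m = "cell (x - y)"
      have "norm (M x y * (complex_of_real (bump N k y - bump N k x) * c y))
          = norm (M x y) * (\<bar>bump N k y - bump N k x\<bar> * norm (c y))"
        by (simp only: norm_mult norm_of_real)
      also have "\<dots> \<le> S ?m * ((modulus N ?m * (bump N k y + 3 * bump N (k - ?m) y)) * norm (c y))"
        using M[OF x y] bump_diff_le[OF N] S by (intro mult_mono mult_right_mono) auto
      also have "\<dots> = S ?m * modulus N ?m * \<bar>g ?m y\<bar>"
        using bump_pos[of N k y] bump_pos[of N "k - ?m" y]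
        by (simp add: g_def abs_mult)
      finally show "norm (M x y * (complex_of_real (bump N k y - bump N k x) * c y))
        \<le> S ?m * modulus N ?m * \<bar>g ?m y\<bar>" .
    qed
    then show "\<bar>norm (\<Sum>\<^sub>\<infinity>y\<in>\<Gamma>. M x y * (complex_of_real (bump N k y - bump N k x) * c y))\<bar>
      \<le> (\<Sum>\<^sub>\<infinity>y\<in>\<Gamma>. S (cell (x - y)) * modulus N (cell (x - y)) * \<bar>g (cell (x - y)) y\<bar>)"
      by simp
  qed
qed

section \<open>Local and global norms\<close>

text \<open>
  By \<open>bump_shift\<close> at the origin, \<open>bump N k x\<close> is controlled by the difference of \<open>k\<close> and \<open>cell x\<close>. Both
  sums are therefore dominated by sums over translates of one summable sequence.
\<close>

lemma bump_sum_le: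
  fixes x :: "real ^ 'n" and \<Lambda> :: "(real ^ 'n) set"
  assumes N: "1 \<le> N"
  shows "finite K \<Longrightarrow> (\<Sum>k\<in>K. bump N k x) \<le> 3 * (\<Sum>\<^sub>\<infinity>k. bump N k (0 :: real ^ 'n))"
    and "at_most_per_ball R \<Lambda> \<Longrightarrow> finite F \<Longrightarrow> F \<subseteq> \<Lambda> \<Longrightarrow>
      (\<Sum>x\<in>F. bump N k x) \<le> R * (3 * (\<Sum>\<^sub>\<infinity>k. bump N k (0 :: real ^ 'n)))"
proof -
  have sb: "(\<lambda>k. bump N k (0 :: real ^ 'n)) summable_on UNIV" using N by (intro summable_bump) auto
  have le: "bump N k x \<le> 3 * bump N (k - cell x) 0" for k and x :: "real ^ 'n"
    using bump_shift[OF N, of k x 0] by simp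
  show "(\<Sum>k\<in>K. bump N k x) \<le> 3 * (\<Sum>\<^sub>\<infinity>k. bump N k (0 :: real ^ 'n))" if "finite K"
  proof -
    have "(\<Sum>k\<in>K. bump N k x) \<le> 3 * (\<Sum>k\<in>K. bump N (k - cell x) 0)"
      unfolding sum_distrib_left by (intro sum_mono le)
    also have "(\<Sum>k\<in>K. bump N (k - cell x) (0 :: real ^ 'n)) = (\<Sum>k\<in>(\<lambda>k. k - cell x) ` K. bump N k 0)"
      by (simp add: sum.reindex)
    also have "\<dots> \<le> (\<Sum>\<^sub>\<infinity>k. bump N k (0 :: real ^ 'n))"
      using that bump_pos by (intro finite_sum_le_infsum sb) (auto intro: less_imp_le)
    finally show ?thesis by simp
  qed
  show "(\<Sum>x\<in>F. bump N k x) \<le> R * (3 * (\<Sum>\<^sub>\<infinity>k. bump N k (0 :: real ^ 'n)))"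
    if "at_most_per_ball R \<Lambda>" "finite F" "F \<subseteq> \<Lambda>"
  proof -
    have bij: "bij_betw (\<lambda>m. k - m) UNIV (UNIV :: (int ^ 'n) set)"
      by (rule bij_betw_byWitness[where f' = "\<lambda>m. k - m"]) auto
    have "(\<Sum>x\<in>F. bump N k x) \<le> (\<Sum>x\<in>F. 3 * bump N (k - cell x) 0)"
      by (intro sum_mono le)
    also have "\<dots> \<le> R * (\<Sum>\<^sub>\<infinity>m. 3 * bump N (k - m) (0 :: real ^ 'n))"
    proof (rule sum_weight_le[OF that norm_diff_same_cell])
      show "(\<lambda>m. 3 * bump N (k - m) (0 :: real ^ 'n)) summable_on UNIV"
        using sb summable_on_reindex_bij_betw[OF bij, of "\<lambda>k. bump N k (0 :: real ^ 'n)"]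
        by (intro summable_on_cmult_right) simp
    qed (auto simp: bump_pos less_imp_le)
    also have "(\<Sum>\<^sub>\<infinity>m. 3 * bump N (k - m) (0 :: real ^ 'n)) = 3 * (\<Sum>\<^sub>\<infinity>m. bump N m (0 :: real ^ 'n))"
      using infsum_reindex_bij_betw[OF bij, of "\<lambda>k. bump N k (0 :: real ^ 'n)"]
      by (simp add: infsum_cmult_right')
    finally show ?thesis .
  qed
qed

text \<open>
  The hypothesis on \<open>b\<close> holds for local \<open>\<ell>\<^sup>p\<close> norms of \<open>f\<close> with any \<open>p\<close>, because they are at most the local
  \<open>\<ell>\<^sup>1\<close> norms. The constant depends on \<open>N\<close>, which is harmless once \<open>N\<close> is fixed.
\<close>

lemma lp_bound_local_norms:
  fixes \<Lambda> :: "(real ^ 'n) set"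
  assumes q: "1 \<le> q" and \<Lambda>: "at_most_per_ball R \<Lambda>" and R: "1 \<le> R" and N: "1 \<le> N"
    and f: "lp_bound q \<Lambda> f B"
    and b: "\<And>k. \<bar>b k\<bar> \<le> (\<Sum>\<^sub>\<infinity>x\<in>\<Lambda>. bump N k x * \<bar>f x\<bar>)"
  shows "lp_bound q UNIV b (R * (3 * (\<Sum>\<^sub>\<infinity>k. bump N k (0 :: real ^ 'n))) * B)"
proof (rule schur_test[OF q f])
  define Z where "Z = 3 * (\<Sum>\<^sub>\<infinity>k. bump N k (0 :: real ^ 'n))"
  have Z: "0 \<le> Z" unfolding Z_def
    by (intro mult_nonneg_nonneg infsum_nonneg) (auto simp: bump_pos less_imp_le)
  then have ZR: "Z \<le> R * Z" using R by (simp add: mult_le_cancel_right1)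
  show "0 \<le> R * Z" using Z R by simp
  show "(\<Sum>k\<in>K. bump N k x) \<le> R * Z" if "finite K" for K and x :: "real ^ 'n"
    using bump_sum_le(1)[OF N that, of x] ZR unfolding Z_def by linarith
  show "(\<Sum>x\<in>F. bump N k x) \<le> R * Z" if "finite F" "F \<subseteq> \<Lambda>" for k F
    using bump_sum_le(2)[OF N \<Lambda> that] by (simp add: Z_def)
qed (auto simp: b less_imp_le[OF bump_pos])

text \<open>
  Conversely, each value of \<open>f\<close> is seen by the local norm at its own cell, and at most \<open>R\<close> points share
  a cell.
\<close>

lemma lp_bound_from_local_norms:
  fixes \<Gamma> :: "(real ^ 'n) set"
  assumes q: "1 \<le> q" and \<Gamma>: "at_most_per_ball R \<Gamma>" and R: "1 \<le> R"
    and a: "lp_bound q UNIV a B" and f: "\<And>x. x \<in> \<Gamma> \<Longrightarrow> \<bar>f x\<bar> \<le> C * \<bar>a (cell x)\<bar>" and C: "0 \<le> C"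
  shows "lp_bound q \<Gamma> f (C * R * B)"
proof (rule schur_test[OF q a])
  show "0 \<le> C * R" using C R by simp
  show "(\<Sum>k\<in>K. C * of_bool (cell x = k)) \<le> C * R" if "finite K" for K x
  proof -
    have "(\<Sum>k\<in>K. C * of_bool (cell x = k)) \<le> C * 1"
      unfolding sum_distrib_left[symmetric]
      using that C by (intro mult_left_mono) (auto simp: of_bool_def)
    also have "\<dots> \<le> C * R" using C R by (intro mult_left_mono) auto
    finally show ?thesis .
  qed
  show "(\<Sum>x\<in>F. C * of_bool (cell x = k)) \<le> C * R" if "finite F" "F \<subseteq> \<Gamma>" for F k
    unfolding sum_distrib_left[symmetric]
    using sum_fibre_le[OF \<Gamma> that norm_diff_same_cell] C by (intro mult_left_mono) auto
  fix x assume x: "x \<in> \<Gamma>"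
  have "(\<Sum>\<^sub>\<infinity>k. C * of_bool (cell x = k) * \<bar>a k\<bar>) = (\<Sum>\<^sub>\<infinity>k\<in>{cell x}. C * \<bar>a k\<bar>)"
    by (rule infsum_cong_neutral) auto
  then show "\<bar>f x\<bar> \<le> (\<Sum>\<^sub>\<infinity>k. C * of_bool (cell x = k) * \<bar>a k\<bar>)"
    using f[OF x] by simp
qed (use C in auto)

section \<open>The projection on bounded sequences\<close>

lemma lp_of_finite_support:
  assumes "1 \<le> p" "finite F" "F \<subseteq> S" "\<And>x. x \<notin> F \<Longrightarrow> c x = 0"
  shows "c \<in> lp S p"
proof (rule lp_norm_le(1)[OF assms(1)])
  have "(\<lambda>x. \<bar>norm (c x)\<bar>) summable_on F" using assms by simp
  then have "(\<lambda>x. \<bar>norm (c x)\<bar>) summable_on S"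
    using assms by (subst summable_on_cong_neutral[where S = S and T = F]) auto
  then show "lp_bound p S (\<lambda>x. norm (c x)) (\<Sum>\<^sub>\<infinity>x\<in>S. \<bar>norm (c x)\<bar>)"
    by (intro lp_bound_of_summable assms)
qed (use assms in auto)

text \<open>
  Read off by applying the operator identity to a unit vector. The matrix identity is the form in
  which \<open>P\<^sup>2 = P\<close> carries over from \<open>\<ell>\<^sup>2\<close> to the other exponents.
\<close>

lemma idempotent_matrix:
  assumes P: "bounded_l2_operator \<Gamma> \<Gamma> P" "represented_by \<Gamma> \<Gamma> P M"
    and PP: "\<forall>c\<in>lp \<Gamma> 2. P (P c) = P c" and xy: "x \<in> \<Gamma>" "y \<in> \<Gamma>"
  shows "((\<lambda>z. M y z * M z x) has_sum M y x) \<Gamma>"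
proof -
  define d where "d = (\<lambda>z. of_bool (z = x) :: complex)"
  have d: "d \<in> lp \<Gamma> 2"
    by (rule lp_of_finite_support[of _ "{x}"]) (use xy in \<open>auto simp: d_def\<close>)
  have Pd: "P d z = M z x" if "z \<in> \<Gamma>" for z
  proof -
    have "((\<lambda>w. M z w * d w) has_sum P d z) \<Gamma>"
      using P(2) d that by (simp add: represented_by_def)
    moreover have "((\<lambda>w. M z w * d w) has_sum M z x) \<Gamma>"
      using has_sum_finiteI[of "{x}" "M z x" "\<lambda>w. M z w * d w"] xy
      by (subst has_sum_cong_neutral[where S = \<Gamma> and T = "{x}"]) (auto simp: d_def)
    ultimately show ?thesis by (rule has_sum_unique)
  qed
  have "P d \<in> lp \<Gamma> 2" using P(1) d by (simp add: bounded_l2_operator_def)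
  then have "((\<lambda>z. M y z * P d z) has_sum P (P d) y) \<Gamma>"
    using P(2) xy by (simp add: represented_by_def)
  moreover have "P (P d) y = M y x" using PP d Pd xy by simp
  moreover have "((\<lambda>z. M y z * P d z) has_sum M y x) \<Gamma> \<longleftrightarrow> ((\<lambda>z. M y z * M z x) has_sum M y x) \<Gamma>"
    using Pd by (intro has_sum_cong) simp
  ultimately show ?thesis by simp
qed

text \<open>
  Every \<open>\<ell>\<^sup>q\<close> consists of bounded sequences, and for these the iterated series converges absolutely, so the
  order of summation may be exchanged.
\<close>

lemma mat_apply_idempotent:
  fixes M :: "real ^ 'n \<Rightarrow> real ^ 'n \<Rightarrow> complex"
  assumes \<Gamma>: "at_most_per_ball R \<Gamma>" and s: "\<And>m. 0 \<le> s m" "s summable_on UNIV"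
    and M: "\<And>x y. x \<in> \<Gamma> \<Longrightarrow> y \<in> \<Gamma> \<Longrightarrow> norm (M x y) \<le> s (cell (x - y))"
    and MM: "\<And>x y. x \<in> \<Gamma> \<Longrightarrow> y \<in> \<Gamma> \<Longrightarrow> ((\<lambda>z. M y z * M z x) has_sum M y x) \<Gamma>"
    and c: "\<And>y. y \<in> \<Gamma> \<Longrightarrow> norm (c y) \<le> B"
  shows "mat_apply \<Gamma> \<Gamma> M (mat_apply \<Gamma> \<Gamma> M c) = mat_apply \<Gamma> \<Gamma> M c"
proof
  fix y
  show "mat_apply \<Gamma> \<Gamma> M (mat_apply \<Gamma> \<Gamma> M c) y = mat_apply \<Gamma> \<Gamma> M c y"
  proof (cases "y \<in> \<Gamma>")
    case y: True
    have sM: "(\<lambda>x. norm (M z x) * norm (c x)) summable_on \<Gamma>"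
      "(\<Sum>\<^sub>\<infinity>x\<in>\<Gamma>. norm (M z x) * norm (c x)) \<le> R * infsum s UNIV * B" if z: "z \<in> \<Gamma>" for z
    proof -
      have B: "0 \<le> B" using c[OF z] norm_ge_zero order_trans by blast
      have "(\<Sum>x\<in>F. norm (M z x) * norm (c x)) \<le> R * infsum s UNIV * B"
        if F: "finite F" "F \<subseteq> \<Gamma>" for F
      proof -
        have "(\<Sum>x\<in>F. norm (M z x) * norm (c x)) \<le> (\<Sum>x\<in>F. s (cell (z - x)) * B)"
          using F M[OF z] c s by (intro sum_mono mult_mono) auto
        also have "\<dots> = (\<Sum>x\<in>F. s (cell (z - x))) * B" by (simp add: sum_distrib_right)
        also have "\<dots> \<le> R * infsum s UNIV * B"
          by (intro mult_right_mono sum_weight_le[OF \<Gamma> F _ s] B norm_diff_same_cell_translates)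
        finally show ?thesis .
      qed
      then show "(\<lambda>x. norm (M z x) * norm (c x)) summable_on \<Gamma>"
        "(\<Sum>\<^sub>\<infinity>x\<in>\<Gamma>. norm (M z x) * norm (c x)) \<le> R * infsum s UNIV * B"
        using nonneg_summable_infsum_le[of \<Gamma> "\<lambda>x. norm (M z x) * norm (c x)"] by auto
    qed
    have "(\<lambda>v. norm (case v of (z, x) \<Rightarrow> M y z * (M z x * c x))) summable_on (\<Gamma> \<times> \<Gamma>)"
      unfolding Infinite_Sum.abs_summable_on_Sigma_iff
    proof (intro conjI ballI)
      fix z assume z: "z \<in> \<Gamma>"
      show "(\<lambda>x. norm (case (z, x) of (z, x) \<Rightarrow> M y z * (M z x * c x))) summable_on \<Gamma>"
        using summable_on_cmult_right[OF sM(1)[OF z], of "norm (M y z)"] by (simp add: norm_mult)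
    next
      show "(\<lambda>z. norm (\<Sum>\<^sub>\<infinity>x\<in>\<Gamma>. norm (case (z, x) of (z, x) \<Rightarrow> M y z * (M z x * c x)))) summable_on \<Gamma>"
      proof (rule summable_on_comparison_test)
        show "(\<lambda>z. s (cell (y - z)) * (R * infsum s UNIV * B)) summable_on \<Gamma>"
          by (intro summable_on_cmult_left row_summable[OF \<Gamma> s])
        fix z assume z: "z \<in> \<Gamma>"
        have nonneg: "0 \<le> (\<Sum>\<^sub>\<infinity>x\<in>\<Gamma>. norm (M z x) * norm (c x))" by (intro infsum_nonneg) auto
        have "norm (M y z) * (\<Sum>\<^sub>\<infinity>x\<in>\<Gamma>. norm (M z x) * norm (c x))
            \<le> s (cell (y - z)) * (R * infsum s UNIV * B)"
          using sM(2)[OF z] M[OF y z] s nonneg by (intro mult_mono) auto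
        then show "norm (\<Sum>\<^sub>\<infinity>x\<in>\<Gamma>. norm (case (z, x) of (z, x) \<Rightarrow> M y z * (M z x * c x)))
            \<le> s (cell (y - z)) * (R * infsum s UNIV * B)"
          using nonneg by (simp add: norm_mult infsum_cmult_right')
      qed simp
    qed
    then have sum2: "(\<lambda>(z, x). M y z * (M z x * c x)) summable_on (\<Gamma> \<times> \<Gamma>)"
      by (rule abs_summable_summable)
    have "mat_apply \<Gamma> \<Gamma> M (mat_apply \<Gamma> \<Gamma> M c) y = (\<Sum>\<^sub>\<infinity>z\<in>\<Gamma>. \<Sum>\<^sub>\<infinity>x\<in>\<Gamma>. M y z * (M z x * c x))"
      using y by (simp add: mat_apply_def infsum_cmult_right' cong: infsum_cong)
    also have "\<dots> = (\<Sum>\<^sub>\<infinity>x\<in>\<Gamma>. \<Sum>\<^sub>\<infinity>z\<in>\<Gamma>. M y z * (M z x * c x))"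
      by (rule infsum_swap_banach[OF sum2])
    also have "\<dots> = (\<Sum>\<^sub>\<infinity>x\<in>\<Gamma>. M y x * c x)"
    proof (rule infsum_cong)
      fix x assume x: "x \<in> \<Gamma>"
      show "(\<Sum>\<^sub>\<infinity>z\<in>\<Gamma>. M y z * (M z x * c x)) = M y x * c x"
        using has_sum_cmult_left[OF MM[OF x y], of "c x"]
        by (intro infsumI) (simp add: mult.assoc)
    qed
    also have "\<dots> = mat_apply \<Gamma> \<Gamma> M c y" using y by (simp add: mat_apply_def)
    finally show ?thesis .
  qed (simp add: mat_apply_def)
qed

section \<open>Lower bounds for all exponents\<close>

definition windowed :: "real \<Rightarrow> int ^ 'n \<Rightarrow> (real ^ 'n \<Rightarrow> complex) \<Rightarrow> real ^ 'n \<Rightarrow> complex" where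
  "windowed N k c = (\<lambda>x. complex_of_real (bump N k x) * c x)"

lemma norm_windowed: "norm (windowed N k c x) = bump N k x * norm (c x)"
  using bump_pos[of N k x] by (simp add: windowed_def norm_mult)

lemma windowed_in_lp:
  fixes c :: "real ^ 'n \<Rightarrow> complex"
  assumes p: "1 \<le> p" and \<Gamma>: "at_most_per_ball R \<Gamma>" and N: "1 \<le> N"
    and c: "\<And>x. x \<in> \<Gamma> \<Longrightarrow> norm (c x) \<le> B" "\<And>x. x \<notin> \<Gamma> \<Longrightarrow> c x = 0"
  shows "windowed N k c \<in> lp \<Gamma> p"
    and "lp_norm \<Gamma> p (windowed N k c) \<le> (\<Sum>\<^sub>\<infinity>x\<in>\<Gamma>. bump N k x * norm (c x))"
proof -
  have "(\<lambda>x. bump N k x) summable_on \<Gamma>"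
    by (rule nonneg_summable_infsum_le(1)[OF _ bump_sum_le(2)[OF N \<Gamma>]])
      (auto simp: bump_pos less_imp_le)
  then have "(\<lambda>x. bump N k x * B) summable_on \<Gamma>" by (rule summable_on_cmult_left)
  then have "(\<lambda>x. norm (windowed N k c x)) summable_on \<Gamma>"
    by (rule summable_on_comparison_test)
      (use c in \<open>auto simp: norm_windowed bump_pos less_imp_le intro: mult_left_mono\<close>)
  then have "lp_bound p \<Gamma> (\<lambda>x. norm (windowed N k c x)) (\<Sum>\<^sub>\<infinity>x\<in>\<Gamma>. norm (windowed N k c x))"
    using lp_bound_of_summable[OF p, of "\<lambda>x. norm (windowed N k c x)" \<Gamma>] by simp
  moreover have "windowed N k c x = 0" if "x \<notin> \<Gamma>" for x
    using c(2)[OF that] by (simp add: windowed_def)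
  ultimately show "windowed N k c \<in> lp \<Gamma> p"
    and "lp_norm \<Gamma> p (windowed N k c) \<le> (\<Sum>\<^sub>\<infinity>x\<in>\<Gamma>. bump N k x * norm (c x))"
    using lp_norm_le[OF p, of \<Gamma> "windowed N k c"] by (simp_all add: norm_windowed)
qed

lemma mat_apply_windowed:
  fixes M :: "real ^ 'n \<Rightarrow> real ^ 'n \<Rightarrow> complex"
  assumes \<Gamma>: "at_most_per_ball R \<Gamma>" and s: "\<And>m. 0 \<le> s m" "s summable_on UNIV" and N: "1 \<le> N"
    and M: "\<And>y. y \<in> \<Gamma> \<Longrightarrow> norm (M x y) \<le> s (cell (x - y))"
    and c: "\<And>y. y \<in> \<Gamma> \<Longrightarrow> norm (c y) \<le> B" and x: "x \<in> \<Lambda>"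
  shows "mat_apply \<Gamma> \<Lambda> M (windowed N k c) x
    = (\<Sum>\<^sub>\<infinity>y\<in>\<Gamma>. M x y * (complex_of_real (bump N k y - bump N k x) * c y))
      + windowed N k (mat_apply \<Gamma> \<Lambda> M c) x"
proof -
  have s1: "(\<lambda>y. M x y * c y) summable_on \<Gamma>"
    by (rule matrix_row_summable[OF \<Gamma> s M c])
  have s2: "(\<lambda>y. M x y * windowed N k c y) summable_on \<Gamma>"
  proof (rule matrix_row_summable[OF \<Gamma> s M])
    show "norm (windowed N k c y) \<le> B" if "y \<in> \<Gamma>" for y
      using c[OF that] bump_le_1[of N k y] bump_pos[of N k y] N mult_mono[of "bump N k y" 1 "norm (c y)" B]
      by (simp add: norm_windowed)
  qed
  let ?b = "complex_of_real (bump N k x)"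
  have "((\<lambda>y. M x y * windowed N k c y + (- ?b) * (M x y * c y)) has_sum
      (\<Sum>\<^sub>\<infinity>y\<in>\<Gamma>. M x y * windowed N k c y) + (- ?b) * (\<Sum>\<^sub>\<infinity>y\<in>\<Gamma>. M x y * c y)) \<Gamma>"
    by (intro has_sum_add has_sum_cmult_right has_sum_infsum s1 s2)
  moreover have "M x y * windowed N k c y + (- ?b) * (M x y * c y)
      = M x y * (complex_of_real (bump N k y - bump N k x) * c y)" for y
    by (simp add: windowed_def algebra_simps)
  ultimately have "(\<Sum>\<^sub>\<infinity>y\<in>\<Gamma>. M x y * (complex_of_real (bump N k y - bump N k x) * c y))
      = (\<Sum>\<^sub>\<infinity>y\<in>\<Gamma>. M x y * windowed N k c y) + (- ?b) * (\<Sum>\<^sub>\<infinity>y\<in>\<Gamma>. M x y * c y)"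
    by (simp add: infsumI)
  then show ?thesis using x by (simp add: mat_apply_def windowed_def)
qed

lemma mat_apply_add:
  assumes "\<And>x. x \<in> \<Lambda> \<Longrightarrow> (\<lambda>y. M x y * c y) summable_on \<Gamma>"
    and "\<And>x. x \<in> \<Lambda> \<Longrightarrow> (\<lambda>y. M x y * d y) summable_on \<Gamma>"
  shows "mat_apply \<Gamma> \<Lambda> M (\<lambda>y. c y + d y) = (\<lambda>x. mat_apply \<Gamma> \<Lambda> M c x + mat_apply \<Gamma> \<Lambda> M d x)"
  using assms by (auto simp: mat_apply_def distrib_left infsum_add)

text \<open>
  The core of the argument. With \<open>w\<close> the multiplication by \<open>bump N k\<close> and \<open>d\<close> in the range of \<open>P\<close>,
  \<open>P (w d) = w d + [P, w] d\<close> and \<open>A (P (w d)) = w (A d) + [A, w] d + A ([P, w] d)\<close>.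
  The lower bound in \<open>\<ell>\<^sup>p\<close>, applied to \<open>w d\<close>, becomes a bound for the local norm of \<open>d\<close> around \<open>k\<close> by that
  of \<open>A d\<close>, with an error formed from the local norms of \<open>d\<close> at all centres.
\<close>

lemma local_lower_bound:
  fixes \<Gamma> \<Lambda> :: "(real ^ 'n) set" and d :: "real ^ 'n \<Rightarrow> complex"
  assumes p: "1 \<le> p" and \<Gamma>: "at_most_per_ball R \<Gamma>" and \<Lambda>: "at_most_per_ball R \<Lambda>"
    and S: "\<And>m. 0 \<le> S m" "S summable_on UNIV" and N: "1 \<le> N" and C: "0 \<le> C"
    and P: "\<And>x y. x \<in> \<Gamma> \<Longrightarrow> y \<in> \<Gamma> \<Longrightarrow> norm (Pm x y) \<le> S (cell (x - y))"
    and A: "\<And>x y. x \<in> \<Lambda> \<Longrightarrow> y \<in> \<Gamma> \<Longrightarrow> norm (Am x y) \<le> S (cell (x - y))"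
    and lower: "\<And>c. c \<in> lp \<Gamma> p \<Longrightarrow> C * lp_norm \<Gamma> p (mat_apply \<Gamma> \<Gamma> Pm c)
        \<le> lp_norm \<Lambda> p (mat_apply \<Gamma> \<Lambda> Am (mat_apply \<Gamma> \<Gamma> Pm c))"
    and d: "\<And>x. x \<in> \<Gamma> \<Longrightarrow> norm (d x) \<le> D" "\<And>x. x \<notin> \<Gamma> \<Longrightarrow> d x = 0"
    and Pd: "mat_apply \<Gamma> \<Gamma> Pm d = d"
    and a: "\<And>j. a j = lp_norm \<Gamma> p (windowed N j d)" "\<And>j. a j \<le> a0"
  shows "C * a k \<le> lp_norm \<Lambda> p (windowed N k (mat_apply \<Gamma> \<Lambda> Am d))
    + (R + R * infsum S UNIV * R + C * R) * (\<Sum>\<^sub>\<infinity>m. S m * modulus N m * (a k + 3 * a (k - m)))"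
proof -
  define E where "E = (\<Sum>\<^sub>\<infinity>m. S m * modulus N m * (a k + 3 * a (k - m)))"
  define u where "u = windowed N k d"
  define e where "e = (\<lambda>x. if x \<in> \<Gamma> then
    \<Sum>\<^sub>\<infinity>y\<in>\<Gamma>. Pm x y * (complex_of_real (bump N k y - bump N k x) * d y) else 0)"
  define f where "f = (\<lambda>x. \<Sum>\<^sub>\<infinity>y\<in>\<Gamma>. Am x y * (complex_of_real (bump N k y - bump N k x) * d y))"
  define g where "g = windowed N k (mat_apply \<Gamma> \<Lambda> Am d)"
  have win: "windowed N j d \<in> lp \<Gamma> p" for j by (rule windowed_in_lp[OF p \<Gamma> N d])
  have bound_a: "lp_bound p \<Gamma> (\<lambda>y. bump N j y * norm (d y)) (a j)" for j
    using lp_bound_lp_norm[OF p win[of j]] by (simp add: a norm_windowed)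
  have u: "u \<in> lp \<Gamma> p" "lp_bound p \<Gamma> (\<lambda>x. norm (u x)) (a k)"
    using win[of k] lp_bound_lp_norm[OF p win[of k]] by (simp_all add: u_def a)
  have uB: "norm (u x) \<le> a k" if "x \<in> \<Gamma>" for x using lp_bound_pointwise[OF p u(2) that] by simp
  have "lp_bound p \<Gamma>
      (\<lambda>x. norm (\<Sum>\<^sub>\<infinity>y\<in>\<Gamma>. Pm x y * (complex_of_real (bump N k y - bump N k x) * d y))) (R * E)"
    unfolding E_def by (rule lp_bound_commutator[OF p \<Gamma> \<Gamma> S N P bound_a a(2)])
  then have e: "lp_bound p \<Gamma> (\<lambda>x. norm (e x)) (R * E)"
    by (rule lp_bound_mono[OF p _ order_refl]) (simp add: e_def)
  have eB: "norm (e x) \<le> R * E" if "x \<in> \<Gamma>" for x using lp_bound_pointwise[OF p e that] by simp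
  have f: "lp_bound p \<Lambda> (\<lambda>x. norm (f x)) (R * E)"
    unfolding f_def E_def by (rule lp_bound_commutator[OF p \<Gamma> \<Lambda> S N A bound_a a(2)])
  have Pu: "mat_apply \<Gamma> \<Gamma> Pm u = (\<lambda>x. e x + u x)"
  proof
    fix x
    show "mat_apply \<Gamma> \<Gamma> Pm u x = e x + u x"
    proof (cases "x \<in> \<Gamma>")
      case True
      show ?thesis
        using mat_apply_windowed[where M = Pm and c = d and \<Lambda> = \<Gamma> and k = k, OF \<Gamma> S N P[OF True] d(1) True]
          True by (simp add: e_def u_def Pd)
    qed (use d in \<open>simp_all add: mat_apply_def e_def u_def windowed_def\<close>)
  qed
  have Ae: "lp_bound p \<Lambda> (\<lambda>x. norm (mat_apply \<Gamma> \<Lambda> Am e x)) (R * infsum S UNIV * (R * E))"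
    by (rule lp_bound_mat_apply[OF p \<Gamma> \<Lambda> S A e])
  have "mat_apply \<Gamma> \<Lambda> Am (mat_apply \<Gamma> \<Gamma> Pm u)
      = (\<lambda>x. mat_apply \<Gamma> \<Lambda> Am e x + mat_apply \<Gamma> \<Lambda> Am u x)"
    unfolding Pu
  proof (rule mat_apply_add)
    fix x assume x: "x \<in> \<Lambda>"
    show "(\<lambda>y. Am x y * e y) summable_on \<Gamma>"
      by (rule matrix_row_summable[where M = "Am x", OF \<Gamma> S A[OF x] eB])
    show "(\<lambda>y. Am x y * u y) summable_on \<Gamma>"
      by (rule matrix_row_summable[where M = "Am x", OF \<Gamma> S A[OF x] uB])
  qed
  moreover have "mat_apply \<Gamma> \<Lambda> Am u x = f x + g x" if "x \<in> \<Lambda>" for x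
    unfolding u_def f_def g_def by (rule mat_apply_windowed[where M = Am and c = d, OF \<Gamma> S N A[OF that] d(1) that])
  ultimately have APu: "mat_apply \<Gamma> \<Lambda> Am (mat_apply \<Gamma> \<Gamma> Pm u) x
      = mat_apply \<Gamma> \<Lambda> Am e x + (f x + g x)" if "x \<in> \<Lambda>" for x
    using that by simp
  have Ad: "lp_bound \<infinity> \<Lambda> (\<lambda>x. norm (mat_apply \<Gamma> \<Lambda> Am d x)) (R * infsum S UNIV * max 0 D)"
    by (rule lp_bound_mat_apply[OF _ \<Gamma> \<Lambda> S A])
      (use d in \<open>auto simp: lp_bound_infinity intro: le_max_iff_disj[THEN iffD2]\<close>)
  have "g \<in> lp \<Lambda> p" unfolding g_def
  proof (rule windowed_in_lp[OF p \<Lambda> N])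
    show "norm (mat_apply \<Gamma> \<Lambda> Am d x) \<le> R * infsum S UNIV * max 0 D" if "x \<in> \<Lambda>" for x
      using lp_bound_pointwise[OF _ Ad that] by simp
  qed (simp add: mat_apply_def)
  then have g: "lp_bound p \<Lambda> (\<lambda>x. norm (g x)) (lp_norm \<Lambda> p g)" by (rule lp_bound_lp_norm[OF p])
  have fg: "lp_bound p \<Lambda> (\<lambda>x. norm (f x + g x)) (R * E + lp_norm \<Lambda> p g)"
    by (rule lp_bound_add[OF p f g]) (simp add: norm_triangle_ineq)
  have "lp_bound p \<Lambda> (\<lambda>x. norm (mat_apply \<Gamma> \<Lambda> Am (mat_apply \<Gamma> \<Gamma> Pm u) x))
      (R * infsum S UNIV * (R * E) + (R * E + lp_norm \<Lambda> p g))"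
    by (rule lp_bound_add[OF p Ae fg]) (simp add: APu norm_triangle_ineq)
  then have upper: "lp_norm \<Lambda> p (mat_apply \<Gamma> \<Lambda> Am (mat_apply \<Gamma> \<Gamma> Pm u))
      \<le> R * infsum S UNIV * (R * E) + (R * E + lp_norm \<Lambda> p g)"
    by (rule lp_norm_le(2)[OF p]) (simp add: mat_apply_def)
  have "mat_apply \<Gamma> \<Gamma> Pm u \<in> lp \<Gamma> p"
    by (rule lp_norm_le(1)[OF p lp_bound_mat_apply[OF p \<Gamma> \<Gamma> S P u(2)]]) (auto simp: mat_apply_def)
  then have "lp_bound p \<Gamma> (\<lambda>x. norm (mat_apply \<Gamma> \<Gamma> Pm u x)) (lp_norm \<Gamma> p (mat_apply \<Gamma> \<Gamma> Pm u))"
    by (rule lp_bound_lp_norm[OF p])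
  then have "lp_bound p \<Gamma> (\<lambda>x. norm (u x)) (lp_norm \<Gamma> p (mat_apply \<Gamma> \<Gamma> Pm u) + R * E)"
  proof (rule lp_bound_add[OF p _ e])
    show "\<bar>norm (u x)\<bar> \<le> \<bar>norm (mat_apply \<Gamma> \<Gamma> Pm u x)\<bar> + \<bar>norm (e x)\<bar>" for x
      using norm_triangle_ineq4[of "e x + u x" "e x"] by (simp add: Pu)
  qed
  then have "a k \<le> lp_norm \<Gamma> p (mat_apply \<Gamma> \<Gamma> Pm u) + R * E"
    using lp_norm_le(2)[OF p, of \<Gamma> u] d by (simp add: a u_def windowed_def)
  then have "C * a k \<le> C * lp_norm \<Gamma> p (mat_apply \<Gamma> \<Gamma> Pm u) + C * (R * E)"
    using C by (simp add: distrib_left[symmetric] mult_left_mono)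
  also have "C * lp_norm \<Gamma> p (mat_apply \<Gamma> \<Gamma> Pm u)
      \<le> R * infsum S UNIV * (R * E) + (R * E + lp_norm \<Lambda> p g)"
    using lower[OF u(1)] upper by linarith
  finally show ?thesis
    unfolding E_def[symmetric] g_def[symmetric] by (simp add: algebra_simps)
qed

text \<open>
  Young's inequality for the error term of \<open>local_lower_bound\<close>.
\<close>

lemma lp_bound_convolved_local_norms:
  fixes a :: "int ^ 'n \<Rightarrow> real"
  assumes q: "1 \<le> q" and a: "lp_bound q UNIV a B" "\<And>k. 0 \<le> a k"
    and s: "\<And>m. 0 \<le> s m" "s summable_on UNIV"
  shows "lp_bound q UNIV (\<lambda>k. \<Sum>\<^sub>\<infinity>m. s m * (a k + 3 * a (k - m))) (4 * infsum s UNIV * B)"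
proof -
  have "lp_bound q UNIV (\<lambda>k. \<Sum>\<^sub>\<infinity>m. s m * (a k + 3 * a (k - m))) (\<Sum>\<^sub>\<infinity>m. s m * (B + 3 * B))"
  proof (rule lp_bound_infsum[OF q _ summable_on_cmult_left[OF s(2)]])
    fix m
    have "lp_bound q UNIV (\<lambda>k. a (k - m)) B"
      by (rule lp_bound_reindex[OF q a(1)]) (auto intro: injI)
    then have "lp_bound q UNIV (\<lambda>k. 3 * a (k - m)) (3 * B)"
      using lp_bound_scale[OF q, of UNIV "\<lambda>k. a (k - m)" B 3] by simp
    then have "lp_bound q UNIV (\<lambda>k. a k + 3 * a (k - m)) (B + 3 * B)"
      by (rule lp_bound_add[OF q a(1)]) (rule abs_triangle_ineq)
    then show "lp_bound q UNIV (\<lambda>k. s m * (a k + 3 * a (k - m))) (s m * (B + 3 * B))"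
      using lp_bound_scale[OF q, of UNIV "\<lambda>k. a k + 3 * a (k - m)" "B + 3 * B" "s m"] s by simp
  next
    fix k
    show "\<bar>\<Sum>\<^sub>\<infinity>m. s m * (a k + 3 * a (k - m))\<bar> \<le> (\<Sum>\<^sub>\<infinity>m. \<bar>s m * (a k + 3 * a (k - m))\<bar>)"
      using a s by (simp add: infsum_nonneg)
  qed
  moreover have "(\<Sum>\<^sub>\<infinity>m. s m * (B + 3 * B)) = 4 * infsum s UNIV * B"
    by (subst infsum_cmult_left') (simp add: algebra_simps)
  ultimately show ?thesis by simp
qed

text \<open>
  Taking \<open>\<ell>\<^sup>q\<close> norms over the centres \<open>k\<close> in \<open>local_lower_bound\<close>, the error is at most half of the left-hand
  side, hence can be absorbed. The constant contains \<open>R\<close>, \<open>N\<close> and \<open>C\<close>, but neither exponent.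
\<close>

lemma lp_lower_bound_all_exponents:
  fixes \<Gamma> \<Lambda> :: "(real ^ 'n) set"
  assumes p: "1 \<le> p" and q: "1 \<le> q" and \<Gamma>: "at_most_per_ball R \<Gamma>" and \<Lambda>: "at_most_per_ball R \<Lambda>"
    and R: "1 \<le> R" and S: "\<And>m. 0 \<le> S m" "S summable_on UNIV" and N: "1 \<le> N" and C: "0 < C"
    and small: "4 * (R + R * infsum S UNIV * R + C * R) * (\<Sum>\<^sub>\<infinity>m. S m * modulus N m) \<le> C / 2"
    and P: "\<And>x y. x \<in> \<Gamma> \<Longrightarrow> y \<in> \<Gamma> \<Longrightarrow> norm (Pm x y) \<le> S (cell (x - y))"
    and A: "\<And>x y. x \<in> \<Lambda> \<Longrightarrow> y \<in> \<Gamma> \<Longrightarrow> norm (Am x y) \<le> S (cell (x - y))"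
    and PP: "\<And>x y. x \<in> \<Gamma> \<Longrightarrow> y \<in> \<Gamma> \<Longrightarrow> ((\<lambda>z. Pm y z * Pm z x) has_sum Pm y x) \<Gamma>"
    and lower: "\<And>c. c \<in> lp \<Gamma> p \<Longrightarrow> C * lp_norm \<Gamma> p (mat_apply \<Gamma> \<Gamma> Pm c)
        \<le> lp_norm \<Lambda> p (mat_apply \<Gamma> \<Lambda> Am (mat_apply \<Gamma> \<Gamma> Pm c))"
    and c: "c \<in> lp \<Gamma> q"
  shows "C * lp_norm \<Gamma> q (mat_apply \<Gamma> \<Gamma> Pm c)
    \<le> 6 * R * (R * (3 * (\<Sum>\<^sub>\<infinity>k. bump N k (0 :: real ^ 'n))))
        * lp_norm \<Lambda> q (mat_apply \<Gamma> \<Lambda> Am (mat_apply \<Gamma> \<Gamma> Pm c))"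
proof -
  define H where "H = R * (3 * (\<Sum>\<^sub>\<infinity>k. bump N k (0 :: real ^ 'n)))"
  define K where "K = R + R * infsum S UNIV * R + C * R"
  define \<delta> where "\<delta> = (\<Sum>\<^sub>\<infinity>m. S m * modulus N m)"
  define d where "d = mat_apply \<Gamma> \<Gamma> Pm c"
  have K: "0 \<le> K" using R C S unfolding K_def by (simp add: infsum_nonneg)
  have s: "0 \<le> S m * modulus N m" "(\<lambda>m. S m * modulus N m) summable_on UNIV" for m
    using S N modulus_bounds(1)[of N m] summable_modulus[OF S] by auto
  have cq: "lp_bound q \<Gamma> (\<lambda>x. norm (c x)) (lp_norm \<Gamma> q c)" by (rule lp_bound_lp_norm[OF q c])
  have d0: "d x = 0" if "x \<notin> \<Gamma>" for x using that by (simp add: d_def mat_apply_def)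
  have "d \<in> lp \<Gamma> q"
    by (rule lp_norm_le(1)[OF q _ d0]) (unfold d_def, rule lp_bound_mat_apply[OF q \<Gamma> \<Gamma> S P cq])
  then have dq: "lp_bound q \<Gamma> (\<lambda>x. norm (d x)) (lp_norm \<Gamma> q d)" by (rule lp_bound_lp_norm[OF q])
  have dB: "norm (d x) \<le> lp_norm \<Gamma> q d" if "x \<in> \<Gamma>" for x
    using lp_bound_pointwise[OF q dq that] by simp
  have Pd: "mat_apply \<Gamma> \<Gamma> Pm d = d"
    unfolding d_def
  proof (rule mat_apply_idempotent[OF \<Gamma> S P PP])
    show "norm (c y) \<le> lp_norm \<Gamma> q c" if "y \<in> \<Gamma>" for y
      using lp_bound_pointwise[OF q cq that] by simp
  qed
  define Ad where "Ad = mat_apply \<Gamma> \<Lambda> Am d"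
  have Ad0: "Ad x = 0" if "x \<notin> \<Lambda>" for x using that by (simp add: Ad_def mat_apply_def)
  have "Ad \<in> lp \<Lambda> q"
    by (rule lp_norm_le(1)[OF q _ Ad0]) (unfold Ad_def, rule lp_bound_mat_apply[OF q \<Gamma> \<Lambda> S A dq])
  then have Adq: "lp_bound q \<Lambda> (\<lambda>x. norm (Ad x)) (lp_norm \<Lambda> q Ad)" by (rule lp_bound_lp_norm[OF q])
  have AdB: "norm (Ad x) \<le> lp_norm \<Lambda> q Ad" if "x \<in> \<Lambda>" for x
    using lp_bound_pointwise[OF q Adq that] by simp

  \<comment> \<open>Local norms with exponent \<open>p\<close>; their dependence on the centre is measured with exponent \<open>q\<close>.\<close>
  define a where "a = (\<lambda>j. lp_norm \<Gamma> p (windowed N j d))"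
  define b where "b = (\<lambda>j. lp_norm \<Lambda> p (windowed N j Ad))"
  have win_d: "lp_bound p \<Gamma> (\<lambda>x. norm (windowed N j d x)) (a j)" for j
    unfolding a_def by (rule lp_bound_lp_norm[OF p windowed_in_lp(1)[OF p \<Gamma> N dB d0]])
  have win_Ad: "lp_bound p \<Lambda> (\<lambda>x. norm (windowed N j Ad x)) (b j)" for j
    unfolding b_def by (rule lp_bound_lp_norm[OF p windowed_in_lp(1)[OF p \<Lambda> N AdB Ad0]])
  have a0: "0 \<le> a j" and b0: "0 \<le> b j" for j
    using lp_bound_nonneg win_d win_Ad by blast+
  \<comment> \<open>This crude bound only shows that \<open>a\<close> lies in \<open>\<ell>\<^sup>q\<close>,
      without which the absorption below would be void.\<close>
  have a_fin: "lp_bound q UNIV a (H * lp_norm \<Gamma> q d)"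
    unfolding H_def
    by (rule lp_bound_local_norms[OF q \<Gamma> R N dq])
      (use windowed_in_lp(2)[OF p \<Gamma> N dB d0] a0 in \<open>simp add: a_def\<close>)
  have b_q: "lp_bound q UNIV b (H * lp_norm \<Lambda> q Ad)"
    unfolding H_def
    by (rule lp_bound_local_norms[OF q \<Lambda> R N Adq])
      (use windowed_in_lp(2)[OF p \<Lambda> N AdB Ad0] b0 in \<open>simp add: b_def\<close>)
  define \<alpha> where "\<alpha> = lp_norm UNIV q (\<lambda>k. complex_of_real (a k))"
  have "(\<lambda>k. complex_of_real (a k)) \<in> lp UNIV q"
    by (rule lp_norm_le(1)[OF q lp_bound_mono[OF q a_fin order_refl]]) auto
  then have "lp_bound q UNIV (\<lambda>k. norm (complex_of_real (a k))) \<alpha>"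
    unfolding \<alpha>_def by (rule lp_bound_lp_norm[OF q])
  then have a_q: "lp_bound q UNIV a \<alpha>" by (rule lp_bound_mono[OF q _ order_refl]) simp
  define E where "E = (\<lambda>k. \<Sum>\<^sub>\<infinity>m. S m * modulus N m * (a k + 3 * a (k - m)))"
  have E0: "0 \<le> E k" for k
    unfolding E_def by (rule infsum_nonneg, rule mult_nonneg_nonneg[OF s(1)]) (simp add: a0)
  have E_q: "lp_bound q UNIV (\<lambda>k. K * E k) (K * (4 * \<delta> * \<alpha>))"
    using lp_bound_scale[OF q lp_bound_convolved_local_norms[OF q a_q a0 s], of K] K
    by (simp add: E_def \<delta>_def)
  have local: "C * a k \<le> b k + K * E k" for k
    unfolding b_def K_def E_def Ad_def
  proof (rule local_lower_bound[OF p \<Gamma> \<Lambda> S N _ P A lower dB d0 Pd])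
    show "a j \<le> H * lp_norm \<Gamma> q d" for j
      using lp_bound_pointwise[OF q a_fin, of j] by simp
  qed (use C in \<open>simp_all add: a_def\<close>)
  have "lp_bound q UNIV (\<lambda>k. C * a k) (H * lp_norm \<Lambda> q Ad + K * (4 * \<delta> * \<alpha>))"
  proof (rule lp_bound_add[OF q b_q E_q])
    show "\<bar>C * a k\<bar> \<le> \<bar>b k\<bar> + \<bar>K * E k\<bar>" for k
      using local[of k] C a0[of k] b0[of k] K E0[of k] by simp
  qed
  then have "lp_bound q UNIV (\<lambda>k. 1 / C * (C * a k)) (\<bar>1 / C\<bar> * (H * lp_norm \<Lambda> q Ad + K * (4 * \<delta> * \<alpha>)))"
    by (rule lp_bound_scale[OF q])
  then have "lp_bound q UNIV (\<lambda>k. norm (complex_of_real (a k)))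
      (\<bar>1 / C\<bar> * (H * lp_norm \<Lambda> q Ad + K * (4 * \<delta> * \<alpha>)))"
    by (rule lp_bound_mono[OF q _ order_refl]) (use C in simp)
  then have "\<alpha> \<le> \<bar>1 / C\<bar> * (H * lp_norm \<Lambda> q Ad + K * (4 * \<delta> * \<alpha>))"
    unfolding \<alpha>_def by (rule lp_norm_le(2)[OF q]) simp
  then have "C * \<alpha> \<le> H * lp_norm \<Lambda> q Ad + 4 * K * \<delta> * \<alpha>"
    using C by (simp add: field_simps)
  also have "4 * K * \<delta> * \<alpha> \<le> C / 2 * \<alpha>"
    using small lp_bound_nonneg[OF a_q] by (intro mult_right_mono) (simp_all add: K_def \<delta>_def)
  finally have absorbed: "C * \<alpha> \<le> 2 * H * lp_norm \<Lambda> q Ad" by simp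
  have "lp_bound q \<Gamma> (\<lambda>x. norm (d x)) (3 * R * \<alpha>)"
  proof (rule lp_bound_from_local_norms[OF q \<Gamma> R a_q])
    fix x assume x: "x \<in> \<Gamma>"
    have "norm (d x) \<le> 3 * bump N (cell x) x * norm (d x)"
      using mult_right_mono[OF bump_cell[OF N, of x], of "norm (d x)"] by simp
    moreover have "bump N (cell x) x * norm (d x) \<le> a (cell x)"
      using lp_bound_pointwise[OF p win_d[of "cell x"] x] by (simp add: norm_windowed)
    ultimately show "\<bar>norm (d x)\<bar> \<le> 3 * \<bar>a (cell x)\<bar>" by simp
  qed simp
  then have "lp_norm \<Gamma> q d \<le> 3 * R * \<alpha>" using d0 by (rule lp_norm_le(2)[OF q])
  then have "C * lp_norm \<Gamma> q d \<le> 3 * R * (C * \<alpha>)"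
    using mult_left_mono[of "lp_norm \<Gamma> q d" "3 * R * \<alpha>" C] C by (simp add: ac_simps)
  also have "\<dots> \<le> 3 * R * (2 * H * lp_norm \<Lambda> q Ad)"
    using absorbed R by (intro mult_left_mono) auto
  finally show ?thesis by (simp add: d_def Ad_def H_def ac_simps)
qed

theorem theorem7p1:
  fixes \<Theta> :: "real ^ 'n \<Rightarrow> real" and C\<^sub>p :: real and R\<^sub>\<Lambda> R\<^sub>\<Gamma> :: ennreal
  assumes "\<Theta> \<in> W_C0_L1" and "C\<^sub>p > 0" and "R\<^sub>\<Lambda> < \<infinity>" and "R\<^sub>\<Gamma> < \<infinity>"
  shows "\<exists>C'>0. \<forall>(\<Lambda> :: (real ^ 'n) set) (\<Gamma> :: (real ^ 'n) set) P A Pm Am (p :: ereal).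
    relatively_separated \<Lambda> \<and> relatively_separated \<Gamma> \<and> rel \<Lambda> \<le> R\<^sub>\<Lambda> \<and> rel \<Gamma> \<le> R\<^sub>\<Gamma> \<and>
    bounded_l2_operator \<Gamma> \<Gamma> P \<and> represented_by \<Gamma> \<Gamma> P Pm \<and>
    bounded_l2_operator \<Gamma> \<Lambda> A \<and> represented_by \<Gamma> \<Lambda> A Am \<and>
    (\<forall>c\<in>lp \<Gamma> 2. P (P c) = P c) \<and>
    (\<forall>x\<in>\<Lambda>. \<forall>y\<in>\<Gamma>. norm (Am x y) \<le> \<Theta> (x - y)) \<and>
    (\<forall>x\<in>\<Gamma>. \<forall>y\<in>\<Gamma>. norm (Pm x y) \<le> \<Theta> (x - y)) \<and>
    1 \<le> p \<and>
    (\<forall>c\<in>lp \<Gamma> p. C\<^sub>p * lp_norm \<Gamma> p (mat_apply \<Gamma> \<Gamma> Pm c)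
        \<le> lp_norm \<Lambda> p (mat_apply \<Gamma> \<Lambda> Am (mat_apply \<Gamma> \<Gamma> Pm c)))
    \<longrightarrow> (\<forall>q::ereal. 1 \<le> q \<longrightarrow> (\<forall>c\<in>lp \<Gamma> q.
          C' * lp_norm \<Gamma> q (mat_apply \<Gamma> \<Gamma> Pm c)
            \<le> lp_norm \<Lambda> q (mat_apply \<Gamma> \<Lambda> Am (mat_apply \<Gamma> \<Gamma> Pm c))))"
proof -
  obtain S where S: "\<And>m. 0 \<le> S m" "S summable_on UNIV" and \<Theta>: "\<And>x. \<bar>\<Theta> x\<bar> \<le> S (cell x)"
    using W_C0_L1_summable_envelope[OF assms(1)] by metis
  define R where "R = max 1 (max (enn2real R\<^sub>\<Lambda>) (enn2real R\<^sub>\<Gamma>))"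
  have R: "1 \<le> R" by (simp add: R_def)
  have sep: "R\<^sub>\<Lambda> \<le> ennreal R" "R\<^sub>\<Gamma> \<le> ennreal R"
  proof -
    have "ennreal (enn2real R\<^sub>\<Lambda>) \<le> ennreal R" "ennreal (enn2real R\<^sub>\<Gamma>) \<le> ennreal R"
      by (intro ennreal_leI; simp add: R_def)+
    then show "R\<^sub>\<Lambda> \<le> ennreal R" "R\<^sub>\<Gamma> \<le> ennreal R" using assms(3,4) by simp_all
  qed
  define K where "K = R + R * infsum S UNIV * R + C\<^sub>p * R"
  have "0 \<le> R * infsum S UNIV * R" "0 \<le> C\<^sub>p * R"
    using R S assms(2) by (simp_all add: infsum_nonneg)
  then have K: "0 < K" using R by (simp add: K_def)
  \<comment> \<open>With this choice the commutator errors, of size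
      \<open>4 * K * (\<Sum>\<^sub>\<infinity>m. S m * modulus N m)\<close>, cost at most half of \<open>C\<^sub>p\<close>.
      All of \<open>S\<close>, \<open>R\<close>, \<open>N\<close> are fixed before the sets and matrices.\<close>
  obtain N where N: "1 \<le> N" "(\<Sum>\<^sub>\<infinity>m. S m * modulus N m) \<le> C\<^sub>p / (8 * K)"
    using modulus_sum_small[OF S, of "C\<^sub>p / (8 * K)"] assms(2) K by auto
  have small: "4 * (R + R * infsum S UNIV * R + C\<^sub>p * R) * (\<Sum>\<^sub>\<infinity>m. S m * modulus N m) \<le> C\<^sub>p / 2"
    using mult_left_mono[OF N(2), of "4 * K"] K unfolding K_def[symmetric] by simp
  define L where "L = 6 * R * (R * (3 * (\<Sum>\<^sub>\<infinity>k. bump N k (0 :: real ^ 'n))))"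
  have "bump N 0 (0 :: real ^ 'n) \<le> (\<Sum>\<^sub>\<infinity>k. bump N k (0 :: real ^ 'n))"
    using finite_sum_le_infsum[of "\<lambda>k. bump N k (0 :: real ^ 'n)" UNIV "{0}"] summable_bump[of N] N
    by (simp add: bump_pos less_imp_le)
  then have L: "0 < L" using R bump_pos[of N 0 "0 :: real ^ 'n"] by (simp add: L_def)
  show ?thesis
  proof (intro exI[of _ "C\<^sub>p / L"] conjI allI impI ballI)
    show "0 < C\<^sub>p / L" using L assms(2) by simp
  next
    fix \<Lambda> \<Gamma> :: "(real ^ 'n) set" and P A Pm Am and p q :: ereal and c
    assume H: "relatively_separated \<Lambda> \<and> relatively_separated \<Gamma> \<and> rel \<Lambda> \<le> R\<^sub>\<Lambda> \<and> rel \<Gamma> \<le> R\<^sub>\<Gamma> \<and>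
      bounded_l2_operator \<Gamma> \<Gamma> P \<and> represented_by \<Gamma> \<Gamma> P Pm \<and>
      bounded_l2_operator \<Gamma> \<Lambda> A \<and> represented_by \<Gamma> \<Lambda> A Am \<and>
      (\<forall>c\<in>lp \<Gamma> 2. P (P c) = P c) \<and>
      (\<forall>x\<in>\<Lambda>. \<forall>y\<in>\<Gamma>. norm (Am x y) \<le> \<Theta> (x - y)) \<and>
      (\<forall>x\<in>\<Gamma>. \<forall>y\<in>\<Gamma>. norm (Pm x y) \<le> \<Theta> (x - y)) \<and>
      1 \<le> p \<and>
      (\<forall>c\<in>lp \<Gamma> p. C\<^sub>p * lp_norm \<Gamma> p (mat_apply \<Gamma> \<Gamma> Pm c)
          \<le> lp_norm \<Lambda> p (mat_apply \<Gamma> \<Lambda> Am (mat_apply \<Gamma> \<Gamma> Pm c)))"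
      and q: "1 \<le> q" and c: "c \<in> lp \<Gamma> q"
    have \<Gamma>: "at_most_per_ball R \<Gamma>" and \<Lambda>: "at_most_per_ball R \<Lambda>"
      using H sep R by (auto intro!: at_most_per_ball_rel intro: order_trans)
    have Pm: "norm (Pm x y) \<le> S (cell (x - y))" if "x \<in> \<Gamma>" "y \<in> \<Gamma>" for x y
      using H that \<Theta>[of "x - y"] by fastforce
    have Am: "norm (Am x y) \<le> S (cell (x - y))" if "x \<in> \<Lambda>" "y \<in> \<Gamma>" for x y
      using H that \<Theta>[of "x - y"] by fastforce
    have PP: "((\<lambda>z. Pm y z * Pm z x) has_sum Pm y x) \<Gamma>" if "x \<in> \<Gamma>" "y \<in> \<Gamma>" for x y
      using idempotent_matrix[of \<Gamma> P Pm, OF _ _ _ that] H by blast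
    have "C\<^sub>p * lp_norm \<Gamma> q (mat_apply \<Gamma> \<Gamma> Pm c)
        \<le> L * lp_norm \<Lambda> q (mat_apply \<Gamma> \<Lambda> Am (mat_apply \<Gamma> \<Gamma> Pm c))"
      unfolding L_def
      by (rule lp_lower_bound_all_exponents[OF _ q \<Gamma> \<Lambda> R S N(1) assms(2) small Pm Am PP _ c])
        (use H in auto)
    then show "C\<^sub>p / L * lp_norm \<Gamma> q (mat_apply \<Gamma> \<Gamma> Pm c)
        \<le> lp_norm \<Lambda> q (mat_apply \<Gamma> \<Lambda> Am (mat_apply \<Gamma> \<Gamma> Pm c))"
      using L by (simp add: field_simps)
  qed
qed

end
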